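(* Let $\mu$ be a subcritical offspring distribution on $\mathbb{Z}_+$ (mean strictly less than $1$) with non-lattice support such that $\mu_k\sim ck^{-\beta}$ as $k\to\infty$ for some $c>0$ and $\beta>2$, and let $\mathcal{T}_n$ be a $\mu$-Galton–Watson tree conditioned to have $n$ vertices. Let $k\ge1$ and let $\mathcal{A}_1,\dots,\mathcal{A}_k\subset\mathbb{Z}_+$ be finite. Then, in distribution as $n\to\infty$, $$\left(\frac{N^{\mathcal{A}_1}(\mathcal{T}_n)-n\mu_{\mathcal{A}_1}}{\sqrt n},\dots,\frac{N^{\mathcal{A}_k}(\mathcal{T}_n)-n\mu_{\mathcal{A}_k}}{\sqrt n}\right)\longrightarrow(Z_{\mathcal{A}_1},\dots,Z_{\mathcal{A}_k}),$$ where $(Z_{\mathcal{A}_1},\dots,Z_{\mathcal{A}_k})$ is a centered Gaussian vector with $Z_{\mathcal{A}_i}\sim\mathcal{N}(0,\mu_{\mathcal{A}_i}(1-\mu_{\mathcal{A}_i}))$ and $\mathrm{Cov}(Z_{\mathcal{A}_i},Z_{\mathcal{A}_j})=\mu_{\mathcal{A}_i\cap\mathcal{A}_j}-\mu_{\mathcal{A}_i}\mu_{\mathcal{A}_j}$ for $i\ne j$.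
   Context: $\mu_i=\mu(\{i\})$, $\mu_{\mathcal{A}}=\sum_{i\in\mathcal{A}}\mu_i$; non-lattice means not contained in $b+d\mathbb{Z}$ for $d\ge2$. A $\mu$-Galton–Watson tree is a random plane tree $\mathcal{T}$ with $\mathbb{P}(\mathcal{T}=T)=\prod_{u\in T}\mu_{k_u(T)}$, $k_u(T)$ the outdegree of $u$; $N^{\mathcal{A}}(T)$ is the number of vertices of $T$ whose outdegree lies in $\mathcal{A}$. *)

theory Defs
  imports "HOL-Probability.Probability" "HOL-Library.Landau_Symbols"
begin

datatype ptree = Node "ptree list"

fun tsize :: "ptree \<Rightarrow> nat" where
  "tsize (Node ts) = 1 + sum_list (map tsize ts)"

fun count_outdeg :: "nat set \<Rightarrow> ptree \<Rightarrow> nat" where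
  "count_outdeg A (Node ts) =
     (if length ts \<in> A then 1 else 0) + sum_list (map (count_outdeg A) ts)"

fun gw_weight :: "(nat \<Rightarrow> real) \<Rightarrow> ptree \<Rightarrow> real" where
  "gw_weight \<mu> (Node ts) = \<mu> (length ts) * prod_list (map (gw_weight \<mu>) ts)"

definition gw_cond :: "(nat \<Rightarrow> real) \<Rightarrow> nat \<Rightarrow> ptree measure" where
  "gw_cond \<mu> n = density (count_space UNIV)
     (\<lambda>T. if tsize T = n
          then ennreal (gw_weight \<mu> T / (\<Sum>S\<in>{S. tsize S = n}. gw_weight \<mu> S))
          else 0)"

definition mu_set :: "(nat \<Rightarrow> real) \<Rightarrow> nat set \<Rightarrow> real" where
  "mu_set \<mu> A = (\<Sum>i\<in>A. \<mu> i)"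

definition offspring_distribution :: "(nat \<Rightarrow> real) \<Rightarrow> bool" where
  "offspring_distribution \<mu> \<longleftrightarrow> (\<forall>k. \<mu> k \<ge> 0) \<and> \<mu> sums 1"

definition nonlattice_support :: "(nat \<Rightarrow> real) \<Rightarrow> bool" where
  "nonlattice_support \<mu> \<longleftrightarrow>
     \<not> (\<exists>(b::int) (d::int). d \<ge> 2 \<and> {k. \<mu> k > 0} \<subseteq> {k. \<exists>m::int. int k = b + d * m})"

definition normal_law :: "real \<Rightarrow> real measure" where
  "normal_law v = (if v = 0 then return borel 0
                   else density lborel (normal_density 0 (sqrt v)))"

definition centered_gaussian :: "(real^'k) measure \<Rightarrow> ('k \<Rightarrow> 'k \<Rightarrow> real) \<Rightarrow> bool" where
  "centered_gaussian \<nu> C \<longleftrightarrow> prob_space \<nu> \<and> sets \<nu> = sets borel \<and>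
     (\<forall>t::real^'k. distr \<nu> borel (\<lambda>x. t \<bullet> x) =
        normal_law (\<Sum>i\<in>UNIV. \<Sum>j\<in>UNIV. t$i * t$j * C i j))"

definition conv_in_distribution :: "(nat \<Rightarrow> (real^'k) measure) \<Rightarrow> (real^'k) measure \<Rightarrow> bool" where
  "conv_in_distribution M \<nu> \<longleftrightarrow>
     (\<forall>f :: real^'k \<Rightarrow> real. continuous_on UNIV f \<and> bounded (range f) \<longrightarrow>
        (\<lambda>n. \<integral>x. f x \<partial>M n) \<longlonglongrightarrow> (\<integral>x. f x \<partial>\<nu>))"

end

(* One big jump. The vertex outdegrees of the conditioned tree are, up to order, i.i.d. variables
   X_1, ..., X_n with law mu conditioned on X_1 + ... + X_n = n - 1 (Otter-Dwass). As the mean m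
   is below 1, this is a large deviation, and for the power tail it is realised by a single summand
   of size about (1 - m) n: exponential tilting by a multiple of ln n / n shows that the event
   without a summand larger than epsilon n is negligible against the probability
   n c ((1 - m) n)^(-beta) of one big jump. Such a jump is not seen by the counts of vertices whose
   outdegrees lie in finite sets, so under the conditioning these counts behave like those of n - 1
   unconditioned variables, and the central limit theorem applies to each of their linear
   combinations. The Cramer-Wold device concludes. *)
theory Submission
  imports Defs "HOL-Real_Asymp.Real_Asymp"
begin

section \<open>The Cramer--Wold device\<close>

text \<open>The removal of the jump decides the form of the local estimates. A list of n + 1 entries
  with sum n is a free list of n entries together with one entry forced to be n minus their sum;
  integrating this entry out leaves an atom of the law at that value. By the law of large numbers
  the value is close to (1 - m) n for typical lists, and there the atom, about c k^(-\<beta>), is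
  nearly constant. So the conditioned remainder is close in law to the free list, and the n + 1
  positions of the jump give the factor n in its probability. An obstacle is that a second moment
  need not exist, since \<beta> may be at most 3; the upper tail is therefore estimated from the
  mean and a fractional moment. Two shifts by one recur: a tree with n + 1 vertices has outdegrees
  with sum n, and only n of them stay free. Centring n free entries by n + 1 means is a
  deterministic error of order n^(-1/2), which the limit does not see.\<close>

lemma integral_tendsto_sandwich:
  fixes f :: "'a \<Rightarrow> real"
  assumes M: "\<forall>\<^sub>F n in sequentially. prob_space (M n)" "\<And>n. sets (M n) = sets \<nu>"
    and \<nu>: "prob_space \<nu>"
    and f: "f \<in> borel_measurable \<nu>" "\<And>x. \<bar>f x\<bar> \<le> C"
    and approx: "\<And>e. e > 0 \<Longrightarrow> \<exists>p h D. p \<in> borel_measurable \<nu> \<and> h \<in> borel_measurable \<nu> \<and>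
       (\<forall>x. \<bar>p x\<bar> \<le> D \<and> \<bar>h x\<bar> \<le> D \<and> \<bar>f x - p x\<bar> \<le> h x) \<and>
       (\<lambda>n. \<integral>x. p x \<partial>M n) \<longlonglongrightarrow> (\<integral>x. p x \<partial>\<nu>) \<and>
       (\<lambda>n. \<integral>x. h x \<partial>M n) \<longlonglongrightarrow> (\<integral>x. h x \<partial>\<nu>) \<and> (\<integral>x. h x \<partial>\<nu>) < e"
  shows "(\<lambda>n. \<integral>x. f x \<partial>M n) \<longlonglongrightarrow> (\<integral>x. f x \<partial>\<nu>)"
proof (rule tendstoI)
  fix e :: real assume e: "e > 0"
  \<comment> \<open>The error bound \<open>h\<close> is itself a test function, so its smallness
    under \<nu> passes to \<open>M n\<close>; this takes the place of tightness. The error under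
    \<nu> enters twice, once inside the error under \<open>M n\<close>, and the convergences for
    \<open>p\<close> and \<open>h\<close> enter once each: four quarters of
    \<open>e\<close>.\<close>
  obtain p h D where p: "p \<in> borel_measurable \<nu>" "h \<in> borel_measurable \<nu>"
    "\<And>x. \<bar>p x\<bar> \<le> D" "\<And>x. \<bar>h x\<bar> \<le> D" "\<And>x. \<bar>f x - p x\<bar> \<le> h x"
    and lp: "(\<lambda>n. \<integral>x. p x \<partial>M n) \<longlonglongrightarrow> (\<integral>x. p x \<partial>\<nu>)"
    and lh: "(\<lambda>n. \<integral>x. h x \<partial>M n) \<longlonglongrightarrow> (\<integral>x. h x \<partial>\<nu>)" and small: "(\<integral>x. h x \<partial>\<nu>) < e / 4"
    using approx[of "e/4"] e by auto
  have key: "\<bar>(\<integral>x. f x \<partial>N) - (\<integral>x. p x \<partial>N)\<bar> \<le> (\<integral>x. h x \<partial>N)"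
    if "prob_space N" and s: "sets N = sets \<nu>" for N
  proof -
    interpret N: prob_space N by fact
    have meas: "f \<in> borel_measurable N" "p \<in> borel_measurable N" "h \<in> borel_measurable N"
      using f(1) p(1,2) by (simp_all cong: measurable_cong_sets add: measurable_cong_sets[OF s refl])
    have int: "integrable N f" "integrable N p" "integrable N h"
      by (rule N.integrable_const_bound[where B=C], simp_all add: f(2) meas)
        (rule N.integrable_const_bound[where B=D], simp_all add: p(3,4) meas)+
    have "\<bar>(\<integral>x. f x \<partial>N) - (\<integral>x. p x \<partial>N)\<bar> = \<bar>\<integral>x. f x - p x \<partial>N\<bar>" using int by simp
    also have "\<dots> \<le> (\<integral>x. \<bar>f x - p x\<bar> \<partial>N)" by (rule integral_abs_bound)
    also have "\<dots> \<le> (\<integral>x. h x \<partial>N)" using int p(5) by (intro integral_mono) auto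
    finally show ?thesis .
  qed
  have "\<forall>\<^sub>F n in sequentially. dist (\<integral>x. p x \<partial>M n) (\<integral>x. p x \<partial>\<nu>) < e / 4"
    "\<forall>\<^sub>F n in sequentially. dist (\<integral>x. h x \<partial>M n) (\<integral>x. h x \<partial>\<nu>) < e / 4"
    using tendstoD[OF lp, of "e/4"] tendstoD[OF lh, of "e/4"] e by auto
  with M(1) show "\<forall>\<^sub>F n in sequentially. dist (\<integral>x. f x \<partial>M n) (\<integral>x. f x \<partial>\<nu>) < e"
  proof eventually_elim
    case (elim n)
    from key[OF elim(1) M(2)] key[OF \<nu> refl] elim(2,3) small show ?case
      unfolding dist_real_def abs_less_iff abs_le_iff by (intro conjI; linarith)
  qed
qed

text \<open>Each generator depends on \<open>x\<close> only through one inner product, so its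
  integrals are controlled by one-dimensional projections. The free phase \<open>b\<close> covers
  sines and constants with a single shape of generator.\<close>

inductive trig_poly :: "('a::real_inner \<Rightarrow> real) \<Rightarrow> bool" where
  cos: "trig_poly (\<lambda>x. a * cos (t \<bullet> x + b))"
| add: "trig_poly f \<Longrightarrow> trig_poly g \<Longrightarrow> trig_poly (\<lambda>x. f x + g x)"

lemma trig_poly_const: "trig_poly (\<lambda>x. c)"
  using trig_poly.cos[of c 0 0] by simp

text \<open>The product-to-sum formula turns sums of cosines into an algebra, which admits
  polynomials in sines as approximants.\<close>

lemma trig_poly_mult:
  assumes "trig_poly f" "trig_poly g"
  shows "trig_poly (\<lambda>x. f x * g x)"
  using assms
proof (induction f rule: trig_poly.induct)
  case (cos a t b)
  from cos.prems show ?case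
  proof (induction g rule: trig_poly.induct)
    case (cos a' t' b')
    have "(\<lambda>x. a * cos (t \<bullet> x + b) * (a' * cos (t' \<bullet> x + b'))) =
      (\<lambda>x. (a * a' / 2) * cos ((t - t') \<bullet> x + (b - b')) + (a * a' / 2) * cos ((t + t') \<bullet> x + (b + b')))"
      by (rule ext) (simp add: cos_add cos_diff inner_left_distrib inner_diff_left sin_add sin_diff algebra_simps)
    then show ?case by (simp only:) (intro trig_poly.intros)
  next
    case (add f g)
    then show ?case by (simp add: distrib_left trig_poly.add)
  qed
next
  case (add f g)
  then show ?case by (simp add: distrib_right trig_poly.add)
qed

lemma trig_poly_sum:
  "finite I \<Longrightarrow> (\<And>i. i \<in> I \<Longrightarrow> trig_poly (f i)) \<Longrightarrow> trig_poly (\<lambda>x. \<Sum>i\<in>I. f i x)"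
  by (induction I rule: finite_induct) (auto intro: trig_poly_const trig_poly.add)

lemma trig_poly_compose_sin:
  fixes P :: "real^'k::finite \<Rightarrow> real"
  assumes "real_polynomial_function P"
  shows "trig_poly (\<lambda>x::real^'k. P (\<chi> i. sin (a * x $ i)))"
  using assms
proof (induction P rule: real_polynomial_function.induct)
  case (linear f)
  interpret f: bounded_linear f by fact
  have "f (\<chi> i. sin (a * x $ i)) = (\<Sum>i\<in>UNIV. f (axis i 1) * cos ((a *\<^sub>R axis i 1) \<bullet> x + (- pi/2)))" for x :: "real^'k"
  proof -
    have "(\<chi> i. sin (a * x $ i)) = (\<Sum>i\<in>UNIV. sin (a * x $ i) *\<^sub>R axis i (1::real))"
      by (simp add: vec_eq_iff axis_def if_distrib cong: if_cong)
    then have "f (\<chi> i. sin (a * x $ i)) = (\<Sum>i\<in>UNIV. f (axis i 1) * sin (a * x $ i))"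
      by (simp add: f.sum f.scaleR mult.commute)
    also have "\<dots> = (\<Sum>i\<in>UNIV. f (axis i 1) * cos ((a *\<^sub>R axis i 1) \<bullet> x + (- pi/2)))"
      by (simp add: cos_diff inner_axis' )
    finally show ?thesis .
  qed
  then show ?case by (simp only:) (intro trig_poly_sum trig_poly.cos; simp)
qed (auto intro: trig_poly.add trig_poly_mult trig_poly_const)

lemma trig_poly_bounded_continuous:
  assumes "trig_poly (f :: 'a::euclidean_space \<Rightarrow> real)"
  shows "continuous_on UNIV f" "\<exists>B. \<forall>x. \<bar>f x\<bar> \<le> B"
proof -
  show "continuous_on UNIV f"
    using assms by (induction rule: trig_poly.induct) (auto intro!: continuous_intros)
  show "\<exists>B. \<forall>x. \<bar>f x\<bar> \<le> B"
    using assms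
  proof (induction rule: trig_poly.induct)
    case (cos a t b)
    then show ?case by (intro exI[of _ "\<bar>a\<bar>"]) (auto simp: abs_mult intro!: mult_left_le)
  next
    case (add f g)
    then obtain B1 B2 where "\<forall>x. \<bar>f x\<bar> \<le> B1" "\<forall>x. \<bar>g x\<bar> \<le> B2" by blast
    then show ?case by (intro exI[of _ "B1 + B2"]) (meson abs_triangle_ineq add_mono order_trans)
  qed
qed

text \<open>Composing with the sine, which is injective on the box, keeps the approximant bounded
  outside the box as well.\<close>
lemma trig_poly_approx:
  fixes f :: "real^'k::finite \<Rightarrow> real"
  assumes f: "continuous_on UNIV f" "\<And>x. \<bar>f x\<bar> \<le> C" and L: "L > 0" and e: "e > 0"
  shows "\<exists>p. trig_poly p \<and> (\<forall>x. \<bar>p x\<bar> \<le> C + e) \<and> (\<forall>x. (\<forall>i. \<bar>x $ i\<bar> \<le> L) \<longrightarrow> \<bar>f x - p x\<bar> \<le> e)"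
proof -
  \<comment> \<open>This scale maps \<open>[-L, L]\<close> onto \<open>[-pi/2, pi/2]\<close>, where
    \<open>arcsin\<close> undoes \<open>sin\<close>.\<close>
  define a where "a = pi / (2 * L)"
  have a: "a > 0" using L by (simp add: a_def)
  \<comment> \<open>\<open>f\<close> read in the coordinates \<open>sin (a * x $ i)\<close>. The
    cube \<open>S\<close> contains every vector of sines, also those of points outside the box, so a
    bound on \<open>P\<close> over \<open>S\<close> bounds the approximant everywhere.\<close>
  define F where "F s = f (\<chi> i. arcsin (s $ i) / a)" for s :: "real^'k"
  define S where "S = (cbox (\<chi> i. -1) (\<chi> i. 1) :: (real^'k) set)"
  have S: "s \<in> S \<longleftrightarrow> (\<forall>i. -1 \<le> s $ i \<and> s $ i \<le> 1)" for s
    by (auto simp: S_def mem_box_cart)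
  have "continuous_on S F" unfolding F_def
  proof (rule continuous_on_compose2[OF f(1)])
    show "continuous_on S (\<lambda>s. \<chi> i. arcsin (s $ i) / a)"
      using a by (intro continuous_intros) (auto simp: S)
  qed auto
  moreover have "compact S" unfolding S_def by (simp add: compact_cbox)
  ultimately obtain P where P: "real_polynomial_function P" "\<And>s. s \<in> S \<Longrightarrow> \<bar>F s - P s\<bar> < e"
    using Stone_Weierstrass_real_polynomial_function[of S F e] e by blast
  define p where "p x = P (\<chi> i. sin (a * x $ i))" for x
  have 1: "trig_poly p" unfolding p_def by (rule trig_poly_compose_sin[OF P(1)])
  have 2: "\<bar>p x\<bar> \<le> C + e" for x
  proof -
    have "(\<chi> i. sin (a * x $ i)) \<in> S" by (simp add: S)
    from P(2)[OF this] f(2)[of "\<chi> i. arcsin ((\<chi> i. sin (a * x $ i)) $ i) / a"] show ?thesis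
      unfolding p_def F_def by linarith
  qed
  have 3: "\<bar>f x - p x\<bar> \<le> e" if x: "\<forall>i. \<bar>x $ i\<bar> \<le> L" for x
  proof -
    have "arcsin (sin (a * x $ i)) = a * x $ i" for i
    proof (rule arcsin_sin)
      have "a * \<bar>x $ i\<bar> \<le> a * L" using a x by (intro mult_left_mono) auto
      also have "a * L = pi / 2" using L by (simp add: a_def)
      finally have "\<bar>a * x $ i\<bar> \<le> pi/2" using a by (simp add: abs_mult)
      then show "- (pi / 2) \<le> a * x $ i" "a * x $ i \<le> pi / 2" by linarith+
    qed
    then have "F (\<chi> i. sin (a * x $ i)) = f x" using a by (simp add: F_def)
    moreover have "(\<chi> i. sin (a * x $ i)) \<in> S" by (simp add: S)
    ultimately show ?thesis using P(2)[of "\<chi> i. sin (a * x $ i)"] unfolding p_def by auto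
  qed
  show ?thesis using 1 2 3 by blast
qed

text \<open>Cosines of projections converge by hypothesis, and their sums approximate
  \<open>f\<close> on a box; the mass outside the box is controlled by a sum of coordinate
  functions, which converges by the same hypothesis. The \<open>M n\<close> are probability measures
  only eventually because a conditioned tree law is the zero measure at sizes of total weight
  zero.\<close>

theorem cramer_wold:
  fixes M :: "nat \<Rightarrow> (real^'k::finite) measure"
  assumes M: "\<forall>\<^sub>F n in sequentially. prob_space (M n)" "\<And>n. sets (M n) = sets borel"
    and \<nu>: "prob_space \<nu>" "sets \<nu> = sets borel"
    and conv: "\<And>t \<phi>. continuous_on UNIV \<phi> \<Longrightarrow> bounded (range \<phi>) \<Longrightarrow>
       (\<lambda>n. \<integral>x. (\<phi> (t \<bullet> x) :: real) \<partial>M n) \<longlonglongrightarrow> (\<integral>x. \<phi> (t \<bullet> x) \<partial>\<nu>)"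
  shows "conv_in_distribution M \<nu>"
  unfolding conv_in_distribution_def
proof (intro allI impI, elim conjE)
  fix f :: "real^'k \<Rightarrow> real"
  assume f: "continuous_on UNIV f" "bounded (range f)"
  interpret \<nu>: prob_space \<nu> by fact
  have int: "integrable N g" if "prob_space N" "sets N = sets borel" "continuous_on UNIV g" "\<And>x. \<bar>g x\<bar> \<le> D"
    for N and g :: "real^'k \<Rightarrow> real" and D
  proof -
    interpret N: prob_space N by fact
    have "g \<in> borel_measurable N"
      using borel_measurable_continuous_onI[OF that(3)] by (simp add: measurable_cong_sets[OF that(2) refl])
    then show ?thesis using that(4) by (intro N.integrable_const_bound[where B=D]) auto
  qed
  have meas: "g \<in> borel_measurable \<nu>" if "continuous_on UNIV g" for g :: "real^'k \<Rightarrow> real"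
    using borel_measurable_continuous_onI[OF that] by (simp add: measurable_cong_sets[OF \<nu>(2) refl])
  obtain C where C: "\<And>x. \<bar>f x\<bar> \<le> C" using f(2) by (auto simp: bounded_iff)
  have C0: "C \<ge> 0" using C[of 0] by linarith
  have trig: "(\<lambda>n. \<integral>x. p x \<partial>M n) \<longlonglongrightarrow> (\<integral>x. p x \<partial>\<nu>)" if "trig_poly p" for p
    using that
  proof (induction rule: trig_poly.induct)
    case (cos a t b)
    have "bounded (range (\<lambda>y. a * cos (y + b)))"
      unfolding bounded_iff by (intro exI[of _ "\<bar>a\<bar>"]) (auto simp: abs_mult intro!: mult_left_le)
    then show ?case
      by (intro conv[of "\<lambda>y. a * cos (y + b)" t]) (auto intro!: continuous_intros)
  next
    case (add f g)
    obtain B1 B2 where B: "\<And>x. \<bar>f x\<bar> \<le> B1" "\<And>x. \<bar>g x\<bar> \<le> B2"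
      using trig_poly_bounded_continuous(2) add.hyps by meson
    have eq: "(\<integral>x. f x + g x \<partial>N) = (\<integral>x. f x \<partial>N) + (\<integral>x. g x \<partial>N)"
      if "prob_space N" "sets N = sets borel" for N
      by (intro Bochner_Integration.integral_add int[OF that _ B(1)] int[OF that _ B(2)]
          trig_poly_bounded_continuous(1) add.hyps)
    have "\<forall>\<^sub>F n in sequentially. (\<integral>x. f x + g x \<partial>M n) = (\<integral>x. f x \<partial>M n) + (\<integral>x. g x \<partial>M n)"
      using M(1) by eventually_elim (rule eq[OF _ M(2)])
    moreover note eq[OF \<nu>]
    ultimately show ?case
      using tendsto_add[OF add.IH] by (simp add: tendsto_cong)
  qed
  \<comment> \<open>A continuous cutoff, equal to 1 for |y| >= L and tending to 0 pointwise as L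
    grows. Its sum over the coordinates dominates the indicator of the complement of the
    box.\<close>
  define \<psi> where "\<psi> L y = min 1 (y\<^sup>2 / L\<^sup>2)" for L y :: real
  have \<psi>b: "0 \<le> \<psi> L y" "\<psi> L y \<le> 1" for L y by (auto simp: \<psi>_def)
  have \<psi>c: "continuous_on UNIV (\<lambda>x. \<psi> L (g x))" if "L \<noteq> 0" "continuous_on UNIV g" for L and g :: "'z::topological_space \<Rightarrow> real"
    using that unfolding \<psi>_def by (intro continuous_intros) auto
  define h where "h L x = (\<Sum>i\<in>UNIV. \<psi> L (x $ i))" for L and x :: "real^'k"
  have hb: "0 \<le> h L x" "h L x \<le> real CARD('k)" for L x
    unfolding h_def using \<psi>b sum_mono[of UNIV "\<lambda>i. \<psi> L (x $ i)" "\<lambda>_. 1"] by (auto intro!: sum_nonneg)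
  have hc: "continuous_on UNIV (h L)" if "L \<noteq> 0" for L
    using that unfolding h_def by (intro continuous_intros \<psi>c) auto
  have hconv: "(\<lambda>n. \<integral>x. h L x \<partial>M n) \<longlonglongrightarrow> (\<integral>x. h L x \<partial>\<nu>)" if L: "L \<noteq> 0" for L
  proof -
    have *: "(\<integral>x. h L x \<partial>N) = (\<Sum>i\<in>UNIV. \<integral>x. \<psi> L (axis i 1 \<bullet> x) \<partial>N)"
      if "prob_space N" "sets N = sets borel" for N
    proof -
      have "integrable N (\<lambda>x. \<psi> L (axis i 1 \<bullet> x))" for i
        by (rule int[OF that, of _ 1]) (use L \<psi>b in \<open>auto intro!: \<psi>c continuous_intros\<close>)
      then show ?thesis unfolding h_def by (simp add: inner_axis')
    qed
    have "\<forall>\<^sub>F n in sequentially. (\<integral>x. h L x \<partial>M n) = (\<Sum>i\<in>UNIV. \<integral>x. \<psi> L (axis i 1 \<bullet> x) \<partial>M n)"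
      using M(1) by eventually_elim (rule *[OF _ M(2)])
    moreover have "(\<lambda>n. \<Sum>i\<in>UNIV. \<integral>x. \<psi> L (axis i 1 \<bullet> x) \<partial>M n) \<longlonglongrightarrow> (\<Sum>i\<in>UNIV. \<integral>x. \<psi> L (axis i 1 \<bullet> x) \<partial>\<nu>)"
      using L \<psi>b by (intro tendsto_sum conv) (auto intro!: \<psi>c continuous_intros exI[of _ 1] simp: bounded_iff)
    ultimately show ?thesis using *[OF \<nu>] by (simp add: tendsto_cong)
  qed
  have hsmall: "\<exists>L>0. (\<integral>x. h L x \<partial>\<nu>) < e" if e: "e > 0" for e
  proof -
    have "(\<lambda>n. \<integral>x. h (real (Suc n)) x \<partial>\<nu>) \<longlonglongrightarrow> (\<integral>x. 0 \<partial>\<nu>)"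
    proof (rule integral_dominated_convergence[where w="\<lambda>_. real CARD('k)"])
      show "AE x in \<nu>. (\<lambda>n. h (real (Suc n)) x) \<longlonglongrightarrow> 0"
      proof (rule AE_I2)
        fix x
        have "(\<lambda>n. \<psi> (real (Suc n)) y) \<longlonglongrightarrow> 0" for y
        proof -
          have "(\<lambda>n. y\<^sup>2 / (real (Suc n))\<^sup>2) \<longlonglongrightarrow> 0" by real_asymp
          from tendsto_min[OF tendsto_const[of 1] this] show ?thesis by (simp add: \<psi>_def)
        qed
        from tendsto_sum[of UNIV, OF this] show "(\<lambda>n. h (real (Suc n)) x) \<longlonglongrightarrow> 0"
          unfolding h_def by simp
      qed
    qed (use hb in \<open>auto intro!: meas hc\<close>)
    then have "\<forall>\<^sub>F n in sequentially. (\<integral>x. h (real (Suc n)) x \<partial>\<nu>) < e"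
      using e by (intro order_tendstoD(2)) auto
    then obtain n where "(\<integral>x. h (real (Suc n)) x \<partial>\<nu>) < e" by (auto simp: eventually_sequentially)
    then show ?thesis by (intro exI[of _ "real (Suc n)"]) auto
  qed
  show "(\<lambda>n. \<integral>x. f x \<partial>M n) \<longlonglongrightarrow> (\<integral>x. f x \<partial>\<nu>)"
  proof (rule integral_tendsto_sandwich[OF M(1) _ \<nu>(1) _ C])
    fix e :: real assume e: "e > 0"
    define e1 where "e1 = e / 4"
    \<comment> \<open>\<open>2 * C + e1\<close> bounds the distance of \<open>f\<close> and
      \<open>p\<close> off the box, as \<open>p\<close> is bounded by \<open>C + e1\<close>. With
      the integral of \<open>h L\<close> below \<open>e / (2 * K)\<close>, the total error stays
      below \<open>e / 4 + e / 2\<close>.\<close>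
    define K where "K = 2 * C + e1"
    have K: "K > 0" using C0 e by (simp add: K_def e1_def)
    obtain L where L: "L > 0" "(\<integral>x. h L x \<partial>\<nu>) < e / (2 * K)" using hsmall[of "e/(2*K)"] e K by auto
    obtain p where p: "trig_poly p" "\<And>x. \<bar>p x\<bar> \<le> C + e1" "\<And>x. (\<forall>i. \<bar>x $ i\<bar> \<le> L) \<Longrightarrow> \<bar>f x - p x\<bar> \<le> e1"
      using trig_poly_approx[OF f(1) C L(1), of e1] e by (auto simp: e1_def)
    define H where "H x = e1 + K * h L x" for x
    have Hi: "(\<integral>x. H x \<partial>N) = e1 + K * (\<integral>x. h L x \<partial>N)" if "prob_space N" "sets N = sets borel" for N
    proof -
      interpret N: prob_space N by fact
      have "integrable N (h L)" using L(1) hb by (intro int[OF that, of _ "real CARD('k)"] hc) auto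
      then show ?thesis unfolding H_def by (simp add: N.prob_space)
    qed
    have "\<bar>f x - p x\<bar> \<le> H x" for x
    proof (cases "\<forall>i. \<bar>x $ i\<bar> \<le> L")
      case True
      with p(3)[of x] show ?thesis using K hb(1)[of L x] by (simp add: H_def add_increasing2)
    next
      case False
      then obtain i where "\<bar>x $ i\<bar> > L" by (auto simp: not_le)
      then have "(x $ i)\<^sup>2 \<ge> L\<^sup>2" using L(1) by (metis abs_le_square_iff abs_of_pos less_imp_le)
      then have "\<psi> L (x $ i) = 1" using L(1) by (simp add: \<psi>_def)
      then have "h L x \<ge> 1" unfolding h_def using member_le_sum[of i UNIV "\<lambda>i. \<psi> L (x $ i)"] \<psi>b by auto
      then have "K * h L x \<ge> K" using K by simp
      then show ?thesis using C[of x] p(2)[of x] e unfolding H_def K_def e1_def by linarith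
    qed
    moreover have "\<bar>H x\<bar> \<le> e1 + K * CARD('k)" for x
      using hb[of L x] K e by (auto simp: H_def e1_def intro!: mult_left_mono)
    moreover have "(\<lambda>n. \<integral>x. H x \<partial>M n) \<longlonglongrightarrow> (\<integral>x. H x \<partial>\<nu>)"
    proof -
      have "\<forall>\<^sub>F n in sequentially. (\<integral>x. H x \<partial>M n) = e1 + K * (\<integral>x. h L x \<partial>M n)"
        using M(1) by eventually_elim (rule Hi[OF _ M(2)])
      moreover have "(\<lambda>n. e1 + K * (\<integral>x. h L x \<partial>M n)) \<longlonglongrightarrow> e1 + K * (\<integral>x. h L x \<partial>\<nu>)"
        using L(1) by (intro tendsto_intros hconv) auto
      ultimately show ?thesis using Hi[OF \<nu>] by (simp add: tendsto_cong)
    qed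
    moreover have "(\<integral>x. H x \<partial>\<nu>) < e"
    proof -
      have "K * (\<integral>x. h L x \<partial>\<nu>) < K * (e / (2 * K))" using L(2) K by (intro mult_strict_left_mono)
      also have "\<dots> = e / 2" using K by simp
      finally show ?thesis using Hi[OF \<nu>] e by (simp add: e1_def)
    qed
    moreover have "continuous_on UNIV H" unfolding H_def using L(1) by (intro continuous_intros hc) auto
    ultimately show "\<exists>p h D. p \<in> borel_measurable \<nu> \<and> h \<in> borel_measurable \<nu> \<and>
       (\<forall>x. \<bar>p x\<bar> \<le> D \<and> \<bar>h x\<bar> \<le> D \<and> \<bar>f x - p x\<bar> \<le> h x) \<and>
       (\<lambda>n. \<integral>x. p x \<partial>M n) \<longlonglongrightarrow> (\<integral>x. p x \<partial>\<nu>) \<and>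
       (\<lambda>n. \<integral>x. h x \<partial>M n) \<longlonglongrightarrow> (\<integral>x. h x \<partial>\<nu>) \<and> (\<integral>x. h x \<partial>\<nu>) < e"
      by (rule_tac exI[of _ p], rule_tac exI[of _ H], rule_tac exI[of _ "max (C + e1) (e1 + K * CARD('k))"])
        (use trig[OF p(1)] trig_poly_bounded_continuous(1)[OF p(1)] in
          \<open>auto simp: le_max_iff_disj p(2) intro!: meas\<close>)
  qed (use M \<nu> meas f in auto)
qed

section \<open>Gaussian vectors and the central limit theorem\<close>

lemma prob_space_std_normal: "prob_space std_normal_distribution"
  using real_dist_normal_dist by (simp add: real_distribution_def)

lemma normal_law_scaled:
  assumes "v > 0"
  shows "normal_law v = distr std_normal_distribution borel (\<lambda>x. sqrt v * x)"
proof -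
  interpret N: prob_space std_normal_distribution by (rule prob_space_std_normal)
  have "distributed std_normal_distribution lborel (\<lambda>x. x) std_normal_density"
    unfolding distributed_def by (auto simp: distr_id2)
  from N.normal_density_affine[OF this, of "sqrt v" 0] assms
  have "distributed std_normal_distribution lborel (\<lambda>x. sqrt v * x) (normal_density 0 (sqrt v))" by simp
  then have "distr std_normal_distribution lborel (\<lambda>x. sqrt v * x) = density lborel (normal_density 0 (sqrt v))"
    by (simp add: distributed_def)
  moreover have "distr std_normal_distribution lborel (\<lambda>x. sqrt v * x) = distr std_normal_distribution borel (\<lambda>x. sqrt v * x)"
    by (rule distr_cong) auto
  ultimately show ?thesis using assms by (simp add: normal_law_def)
qed

lemma real_distribution_normal_law: "v \<ge> 0 \<Longrightarrow> real_distribution (normal_law v)"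
proof (cases "v = 0")
  case True
  interpret prob_space "return borel (0::real)" by (rule prob_space_return) simp
  show ?thesis using True by (simp add: normal_law_def real_distribution_def real_distribution_axioms_def prob_space_axioms)
next
  case False
  assume "v \<ge> 0"
  with False normal_law_scaled[of v] prob_space_std_normal show ?thesis
    by (simp add: prob_space.real_distribution_distr)
qed

lemma char_distr_scaled:
  assumes "f \<in> borel_measurable M"
  shows "char (distr M borel (\<lambda>x. a * f x)) t = char (distr M borel f) (t * a)"
  using assms by (simp add: char_def integral_distr mult.assoc)

lemma char_normal_law:
  assumes "v \<ge> 0"
  shows "char (normal_law v) t = complex_of_real (exp (- (v * t\<^sup>2) / 2))"
proof (cases "v = 0")
  case True
  then show ?thesis by (simp add: normal_law_def char_def integral_return)
next
  case False
  with assms have v: "v > 0" by simp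
  have "char (normal_law v) t = char (distr std_normal_distribution borel (\<lambda>x. x)) (t * sqrt v)"
    unfolding normal_law_scaled[OF v] by (rule char_distr_scaled) simp
  also have "distr std_normal_distribution borel (\<lambda>x. x) = std_normal_distribution"
    by (rule distr_id2) simp
  finally show ?thesis using v by (simp add: char_std_normal_distribution power_mult_distrib mult.commute)
qed

text \<open>A sum of the rank-one matrices of the vectors \<open>w b\<close> is the covariance of
  these vectors weighted by independent standard normals, so no matrix root has to be taken.
  Directions of variance 0 are included.\<close>

lemma gaussian_linear_image:
  fixes w :: "nat \<Rightarrow> 'a::euclidean_space"
  shows "\<exists>\<nu>. prob_space \<nu> \<and> sets \<nu> = sets borel \<and>
    (\<forall>t. distr \<nu> borel (\<lambda>x. t \<bullet> x) = normal_law (\<Sum>b\<in>{..N}. (t \<bullet> w b)\<^sup>2))"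
proof -
  define M where "M = PiM {..N} (\<lambda>_. std_normal_distribution)"
  interpret P: product_prob_space "\<lambda>_. std_normal_distribution" "{..N}"
    by (simp add: product_prob_space_def product_sigma_finite_def product_prob_space_axioms_def
        prob_space_std_normal prob_space_imp_sigma_finite)
  have "prob_space M" unfolding M_def by (rule P.prob_space_axioms)
  then interpret M: prob_space M .
  have comp[measurable]: "(\<lambda>\<omega>. \<omega> b) \<in> borel_measurable M" if "b \<le> N" for b
    using measurable_component_singleton[of b "{..N}" "\<lambda>_. std_normal_distribution"] that by (simp add: M_def)
  have comp_distr: "distr M borel (\<lambda>\<omega>. \<omega> b) = std_normal_distribution" if "b \<le> N" for b
  proof -
    have "distr M std_normal_distribution (\<lambda>\<omega>. \<omega> b) = std_normal_distribution"
      unfolding M_def using that by (intro distr_PiM_component) (auto simp: prob_space_std_normal)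
    moreover have "distr M std_normal_distribution (\<lambda>\<omega>. \<omega> b) = distr M borel (\<lambda>\<omega>. \<omega> b)"
      by (rule distr_cong) auto
    ultimately show ?thesis by simp
  qed
  \<comment> \<open>The joint law of all coordinates is the product measure itself, which is the
    criterion for independence.\<close>
  have indep0: "M.indep_vars (\<lambda>_. borel) (\<lambda>b \<omega>. \<omega> b) {..N}"
  proof (subst M.indep_vars_iff_distr_eq_PiM')
    have "distr M (Pi\<^sub>M {..N} (\<lambda>_. borel)) (\<lambda>\<omega>. \<lambda>b\<in>{..N}. \<omega> b) = distr M M (\<lambda>\<omega>. \<omega>)"
      by (rule distr_cong) (auto simp: M_def space_PiM PiE_restrict intro!: sets_PiM_cong)
    also have "\<dots> = M" by (rule distr_id)
    also have "\<dots> = (\<Pi>\<^sub>M b\<in>{..N}. distr M borel (\<lambda>\<omega>. \<omega> b))"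
      unfolding M_def by (rule PiM_cong) (auto simp: comp_distr[unfolded M_def])
    finally show "distr M (Pi\<^sub>M {..N} (\<lambda>_. borel)) (\<lambda>\<omega>. \<lambda>b\<in>{..N}. \<omega> b) = (\<Pi>\<^sub>M b\<in>{..N}. distr M borel (\<lambda>\<omega>. \<omega> b))" .
  qed auto
  define Z where "Z \<omega> = (\<Sum>b\<in>{..N}. \<omega> b *\<^sub>R w b)" for \<omega>
  have Z[measurable]: "Z \<in> borel_measurable M" unfolding Z_def by measurable
  define \<nu> where "\<nu> = distr M borel Z"
  have "prob_space \<nu>" unfolding \<nu>_def by (rule M.prob_space_distr) simp
  moreover have "sets \<nu> = sets borel" by (simp add: \<nu>_def)
  moreover have "distr \<nu> borel (\<lambda>x. t \<bullet> x) = normal_law (\<Sum>b\<in>{..N}. (t \<bullet> w b)\<^sup>2)" for t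
  proof (rule Levy_uniqueness)
    have eq: "distr \<nu> borel (\<lambda>x. t \<bullet> x) = distr M borel (\<lambda>\<omega>. \<Sum>b\<in>{..N}. (t \<bullet> w b) * \<omega> b)"
      unfolding \<nu>_def by (subst distr_distr) (auto simp: Z_def inner_sum_right o_def mult.commute)
    show "real_distribution (distr \<nu> borel (\<lambda>x. t \<bullet> x))"
      unfolding eq by (rule M.real_distribution_distr) measurable
    show "real_distribution (normal_law (\<Sum>b\<in>{..N}. (t \<bullet> w b)\<^sup>2))"
      by (intro real_distribution_normal_law sum_nonneg) simp
    \<comment> \<open>Characteristic functions treat the point mass and the density in
      \<open>normal_law\<close> at once.\<close>
    show "char (distr \<nu> borel (\<lambda>x. t \<bullet> x)) = char (normal_law (\<Sum>b\<in>{..N}. (t \<bullet> w b)\<^sup>2))"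
    proof
      fix s
      have "M.indep_vars (\<lambda>_. borel) (\<lambda>b \<omega>. (t \<bullet> w b) * \<omega> b) {..N}"
        by (rule M.indep_vars_compose2[OF indep0]) simp
      then have "char (distr \<nu> borel (\<lambda>x. t \<bullet> x)) s = (\<Prod>b\<in>{..N}. char (distr M borel (\<lambda>\<omega>. (t \<bullet> w b) * \<omega> b)) s)"
        unfolding eq by (rule M.char_distr_sum)
      also have "\<dots> = (\<Prod>b\<in>{..N}. complex_of_real (exp (- ((t \<bullet> w b)\<^sup>2 * s\<^sup>2) / 2)))"
        by (intro prod.cong refl, subst char_distr_scaled)
           (auto simp: comp_distr char_std_normal_distribution power_mult_distrib mult.commute)
      also have "\<dots> = complex_of_real (exp (- ((\<Sum>b\<in>{..N}. (t \<bullet> w b)\<^sup>2) * s\<^sup>2) / 2))"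
        by (simp add: sum_distrib_right sum_divide_distrib exp_sum flip: of_real_prod sum_negf)
      also have "\<dots> = char (normal_law (\<Sum>b\<in>{..N}. (t \<bullet> w b)\<^sup>2)) s"
        by (subst char_normal_law) (auto intro: sum_nonneg)
      finally show "char (distr \<nu> borel (\<lambda>x. t \<bullet> x)) s = char (normal_law (\<Sum>b\<in>{..N}. (t \<bullet> w b)\<^sup>2)) s" .
    qed
  qed
  ultimately show ?thesis by blast
qed

section \<open>Characteristic functions of i.i.d. lists and their central limit theorem\<close>

lemma integral_bind_pmf_real:
  fixes f :: "'a \<Rightarrow> real"
  assumes "\<And>x. \<bar>f x\<bar> \<le> B"
  shows "(\<integral>x. f x \<partial>bind_pmf M N) = (\<integral>x. \<integral>y. f y \<partial>N x \<partial>M)"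
  unfolding measure_pmf_bind
  by (rule integral_bind[where K="count_space UNIV" and B=B and B'=1])
     (auto simp: assms measure_pmf.emeasure_space_1 measurable_def space_subprob_algebra
        intro: prob_space_imp_subprob_space measure_pmf.prob_space_axioms measure_pmf.finite_measure)

lemma integral_bind_pmf_complex:
  fixes f :: "'a \<Rightarrow> complex"
  assumes f: "\<And>x. norm (f x) \<le> B"
  shows "(\<integral>x. f x \<partial>bind_pmf M N) = (\<integral>x. \<integral>y. f y \<partial>N x \<partial>M)"
proof -
  have int: "integrable (measure_pmf q) f" for q
    using f by (intro measure_pmf.integrable_const_bound[where B=B]) auto
  have "norm (\<integral>y. f y \<partial>N x) \<le> B" for x
    using f by (intro order_trans[OF integral_norm_bound] measure_pmf.integral_le_const integrable_norm int) auto
  then have int2: "integrable (measure_pmf M) (\<lambda>x. \<integral>y. f y \<partial>N x)"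
    by (intro measure_pmf.integrable_const_bound[where B=B]) auto
  have "\<bar>Re (f x)\<bar> \<le> B" "\<bar>Im (f x)\<bar> \<le> B" for x
    using abs_Re_le_cmod[of "f x"] abs_Im_le_cmod[of "f x"] f[of x] by linarith+
  then show ?thesis
    by (intro complex_eqI) (simp_all add: int int2 integral_bind_pmf_real[of _ B] flip: integral_Re integral_Im)
qed

lemma integral_replicate_pmf_prod:
  fixes z :: "'a \<Rightarrow> complex"
  assumes z: "\<And>x. norm (z x) \<le> 1"
  shows "(\<integral>xs. prod_list (map z xs) \<partial>replicate_pmf n p) = (\<integral>x. z x \<partial>measure_pmf p) ^ n"
proof (induction n)
  case (Suc n)
  have b: "norm (prod_list (map z xs)) \<le> 1" for xs
    by (induction xs) (auto simp: norm_mult z intro!: mult_le_one)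
  have "replicate_pmf (Suc n) p = bind_pmf p (\<lambda>x. map_pmf (Cons x) (replicate_pmf n p))"
    by (simp add: map_pmf_def)
  then have "(\<integral>xs. prod_list (map z xs) \<partial>replicate_pmf (Suc n) p) =
    (\<integral>x. \<integral>xs. prod_list (map z xs) \<partial>map_pmf (Cons x) (replicate_pmf n p) \<partial>measure_pmf p)"
    by (simp only: integral_bind_pmf_complex[where f="\<lambda>xs. prod_list (map z xs)", OF b])
  then show ?case by (simp add: Suc.IH)
qed simp

lemma char_replicate_pmf:
  fixes g :: "'a \<Rightarrow> real"
  shows "char (distr (replicate_pmf n p) borel (\<lambda>xs. a * sum_list (map g xs) + b)) t =
    iexp (t * b) * char (distr p borel g) (t * a) ^ n"
proof -
  have "iexp (t * (a * sum_list (map g xs) + b)) = iexp (t * b) * prod_list (map (\<lambda>x. iexp (t * a * g x)) xs)" for xs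
    by (induction xs) (auto simp: algebra_simps exp_add)
  then show ?thesis
    by (simp add: char_def integral_distr integral_replicate_pmf_prod)
qed

text \<open>The power is \<open>n\<close> while the scale is \<open>sqrt (Suc n)\<close>: once the
  jump is removed, \<open>n\<close> free entries remain out of \<open>n + 1\<close> vertices.
  Boundedness of \<open>X\<close> makes the remainder in the expansion of the characteristic
  function explicitly cubic.\<close>

lemma char_clt_tendsto:
  fixes X :: "'a \<Rightarrow> real"
  assumes X: "\<And>x. \<bar>X x\<bar> \<le> B" and mean: "measure_pmf.expectation p X = 0"
    and var: "measure_pmf.expectation p (\<lambda>x. (X x)\<^sup>2) = v"
  shows "(\<lambda>n. char (distr p borel X) (t / sqrt (Suc n)) ^ n) \<longlonglongrightarrow> complex_of_real (exp (- (v * t\<^sup>2) / 2))"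
proof -
  define \<phi> where "\<phi> s = char (distr p borel X) s" for s
  interpret D: real_distribution "distr p borel X"
    by (rule prob_space.real_distribution_distr[OF measure_pmf.prob_space_axioms]) simp
  have B: "B \<ge> 0" using X[of undefined] by linarith
  have "(X x)\<^sup>2 \<le> B\<^sup>2" for x
    using power_mono[OF X[of x], of 2] by simp
  then have int: "integrable p X" "integrable p (\<lambda>x. (X x)\<^sup>2)"
    by (intro measure_pmf.integrable_const_bound[where B=B] measure_pmf.integrable_const_bound[where B="B\<^sup>2"];
        simp add: X)+
  have v0: "v \<ge> 0" unfolding var[symmetric] by simp
  have approx: "cmod (\<phi> s - (1 - s\<^sup>2 * v / 2)) \<le> \<bar>s\<bar>^3 * B^3" for s
  proof -
    have "cmod (\<phi> s - (1 - s\<^sup>2 * v / 2)) \<le> (s\<^sup>2 / 6) * measure_pmf.expectation p (\<lambda>x. min (6 * (X x)\<^sup>2) (\<bar>s\<bar> * \<bar>X x\<bar>^3))"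
      unfolding \<phi>_def
      by (rule prob_space.char_approx3'[OF measure_pmf.prob_space_axioms _ int mean]) (auto simp: mean var)
    also have "\<dots> \<le> (s\<^sup>2 / 6) * (\<bar>s\<bar> * B^3)"
    proof (intro mult_left_mono measure_pmf.integral_le_const)
      show "integrable p (\<lambda>x. min (6 * (X x)\<^sup>2) (\<bar>s\<bar> * \<bar>X x\<bar>^3))"
        by (rule measure_pmf.integrable_const_bound[where B="\<bar>s\<bar> * B^3"])
           (auto intro!: min.coboundedI2 mult_left_mono power_mono X)
    qed (auto intro!: min.coboundedI2 mult_left_mono power_mono X)
    also have "\<dots> \<le> \<bar>s\<bar>^3 * B^3"
    proof -
      have "\<bar>s\<bar>^3 * B^3 = s\<^sup>2 * \<bar>s\<bar> * B^3" by (simp add: power3_eq_cube power2_eq_square)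
      moreover have "0 \<le> s\<^sup>2 * \<bar>s\<bar> * B^3" using B by simp
      moreover have "(s\<^sup>2 / 6) * (\<bar>s\<bar> * B^3) = (s\<^sup>2 * \<bar>s\<bar> * B^3) / 6" by simp
      ultimately show ?thesis by linarith
    qed
    finally show ?thesis .
  qed
  \<comment> \<open>The quadratic Taylor polynomial at \<open>t / sqrt (Suc n)\<close>. Once its
    modulus is at most 1, the \<open>n\<close>-th powers differ by at most \<open>n\<close> times a
    cubic remainder, which is of order n^(-3/2).\<close>
  define w where "w n = 1 - (t / sqrt (Suc n))\<^sup>2 * v / 2" for n :: nat
  have w1: "\<forall>\<^sub>F n in sequentially. \<bar>w n\<bar> \<le> 1"
  proof -
    have "(\<lambda>n. (t\<^sup>2 * v / 2) * (1 / real (Suc n))) \<longlonglongrightarrow> 0"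
      by (intro tendsto_mult_right_zero) real_asymp
    moreover have "(t\<^sup>2 * v / 2) * (1 / real (Suc n)) = (t / sqrt (Suc n))\<^sup>2 * v / 2" for n
      by (simp add: power_divide field_simps)
    ultimately have "(\<lambda>n. (t / sqrt (Suc n))\<^sup>2 * v / 2) \<longlonglongrightarrow> 0" by (simp only:)
    then have "\<forall>\<^sub>F n in sequentially. (t / sqrt (Suc n))\<^sup>2 * v / 2 < 1" by (rule order_tendstoD) simp
    then show ?thesis
    proof eventually_elim
      case (elim n)
      moreover have "(t / sqrt (Suc n))\<^sup>2 * v / 2 \<ge> 0" using v0 by simp
      ultimately show ?case unfolding w_def by linarith
    qed
  qed
  have "\<forall>\<^sub>F n in sequentially. norm (\<phi> (t / sqrt (Suc n)) ^ n - complex_of_real (w n) ^ n) \<le> real n * (\<bar>t / sqrt (Suc n)\<bar>^3 * B^3)"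
    using w1
  proof eventually_elim
    case (elim n)
    have "norm (\<phi> (t / sqrt (Suc n)) ^ n - complex_of_real (w n) ^ n) \<le> n * norm (\<phi> (t / sqrt (Suc n)) - complex_of_real (w n))"
      using elim by (intro norm_power_diff) (auto simp: \<phi>_def D.cmod_char_le_1)
    also have "\<dots> \<le> n * (\<bar>t / sqrt (Suc n)\<bar>^3 * B^3)"
      using approx[of "t / sqrt (Suc n)"] by (intro mult_left_mono) (auto simp: w_def)
    finally show ?case .
  qed
  moreover have "(\<lambda>n. real n * (\<bar>t / sqrt (Suc n)\<bar>^3 * B^3)) \<longlonglongrightarrow> 0"
  proof -
    have "(\<lambda>n. \<bar>t\<bar>^3 * B^3 * (real n * (1 / sqrt (Suc n))^3)) \<longlonglongrightarrow> \<bar>t\<bar>^3 * B^3 * 0"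
      by (intro tendsto_mult_left) real_asymp
    then show ?thesis by (simp add: power_divide mult_ac)
  qed
  ultimately have diff: "(\<lambda>n. \<phi> (t / sqrt (Suc n)) ^ n - complex_of_real (w n) ^ n) \<longlonglongrightarrow> 0"
    by (rule Lim_null_comparison)
  have "(\<lambda>n. w n ^ n) \<longlonglongrightarrow> exp (- (v * t\<^sup>2) / 2)"
  proof -
    define a where "a = v * t\<^sup>2 / 2"
    have "w n = 1 - a / Suc n" for n by (simp add: w_def a_def power_divide mult.commute)
    \<comment> \<open>The exponential limit is known for the exponent \<open>Suc n\<close>; the
      surplus factor tends to 1 and is divided off.\<close>
    moreover have "(\<lambda>n. (1 - a / Suc n) ^ n) \<longlonglongrightarrow> exp (- a)"
    proof -
      have "(\<lambda>n. a * (1 / real (Suc n))) \<longlonglongrightarrow> 0" by (intro tendsto_mult_right_zero) real_asymp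
      then have lim1: "(\<lambda>n. 1 - a / Suc n) \<longlonglongrightarrow> 1"
        using tendsto_diff[OF tendsto_const[of 1]] by fastforce
      have "(\<lambda>n. (1 + (- a) / real (Suc n)) ^ Suc n) \<longlonglongrightarrow> exp (- a)"
        by (rule LIMSEQ_Suc[OF tendsto_exp_limit_sequentially])
      from tendsto_divide[OF this lim1]
      have "(\<lambda>n. (1 - a / real (Suc n)) ^ Suc n / (1 - a / real (Suc n))) \<longlonglongrightarrow> exp (- a)" by simp
      moreover have "\<forall>\<^sub>F n in sequentially. (1 - a / real (Suc n)) ^ Suc n / (1 - a / real (Suc n)) = (1 - a / real (Suc n)) ^ n"
        using tendsto_imp_eventually_ne[OF lim1 zero_neq_one[symmetric]] by eventually_elim simp
      ultimately show ?thesis by (rule Lim_transform_eventually)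
    qed
    ultimately show ?thesis by (simp add: a_def)
  qed
  then have "(\<lambda>n. complex_of_real (w n ^ n)) \<longlonglongrightarrow> complex_of_real (exp (- (v * t\<^sup>2) / 2))"
    by (rule tendsto_of_real)
  from tendsto_add[OF diff this] show ?thesis by (simp add: \<phi>_def)
qed

text \<open>The centring takes \<open>Suc n\<close> means for only \<open>n\<close> entries. The
  surplus mean becomes a shift by \<open>- e / sqrt (Suc n)\<close>, hence a phase factor tending to
  1, and the limit law is the usual one.\<close>

lemma clt_replicate_pmf:
  fixes p :: "'a pmf" and g :: "'a \<Rightarrow> real" and \<phi> :: "real \<Rightarrow> real"
  assumes g: "\<And>x. \<bar>g x\<bar> \<le> B" and \<phi>: "continuous_on UNIV \<phi>" "bounded (range \<phi>)"
  defines "e \<equiv> measure_pmf.expectation p g"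
  shows "(\<lambda>n. \<integral>xs. \<phi> ((sum_list (map g xs) - real (Suc n) * e) / sqrt (Suc n)) \<partial>replicate_pmf n p)
    \<longlonglongrightarrow> (\<integral>x. \<phi> x \<partial>normal_law (measure_pmf.variance p g))"
proof -
  define v where "v = measure_pmf.variance p g"
  have v0: "v \<ge> 0" unfolding v_def by (rule measure_pmf.variance_positive)
  define X where "X n xs = (sum_list (map g xs) - real (Suc n) * e) / sqrt (Suc n)" for n :: nat and xs
  define h where "h x = g x - e" for x
  have intg: "integrable p g" using g by (intro measure_pmf.integrable_const_bound[where B=B]) auto
  have h: "\<bar>h x\<bar> \<le> B + \<bar>e\<bar>" for x using g[of x] unfolding h_def by linarith
  have h0: "measure_pmf.expectation p h = 0"
    using intg by (simp add: h_def[abs_def] e_def)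
  have hv: "measure_pmf.expectation p (\<lambda>x. (h x)\<^sup>2) = v"
    by (simp add: h_def v_def e_def)
  have "weak_conv_m (\<lambda>n. distr (replicate_pmf n p) borel (X n)) (normal_law v)"
  proof (rule levy_continuity)
    show "real_distribution (distr (replicate_pmf n p) borel (X n))" for n
      by (rule prob_space.real_distribution_distr[OF measure_pmf.prob_space_axioms]) simp
    show "real_distribution (normal_law v)" by (rule real_distribution_normal_law[OF v0])
    fix t
    have eq: "char (distr (replicate_pmf n p) borel (X n)) t =
      iexp (t * (- e / sqrt (Suc n))) * char (distr p borel h) (t / sqrt (Suc n)) ^ n" for n
    proof -
      have "X n xs = 1 / sqrt (Suc n) * sum_list (map h xs) + (- e / sqrt (Suc n))"
        if "xs \<in> set_pmf (replicate_pmf n p)" for xs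
      proof -
        have "sum_list (map h xs) = sum_list (map g xs) - real (length xs) * e"
          by (induction xs) (auto simp: h_def algebra_simps)
        moreover have "length xs = n" using that by (simp add: set_replicate_pmf)
        ultimately show ?thesis by (simp add: X_def field_simps)
      qed
      then have "distr (replicate_pmf n p) borel (X n) =
        distr (replicate_pmf n p) borel (\<lambda>xs. 1 / sqrt (Suc n) * sum_list (map h xs) + (- e / sqrt (Suc n)))"
        by (intro distr_cong_AE) (auto simp: AE_measure_pmf_iff)
      then show ?thesis by (simp only: char_replicate_pmf) simp
    qed
    have "(\<lambda>n. (t * (- e)) * (1 / sqrt (Suc n))) \<longlonglongrightarrow> 0"
      by (intro tendsto_mult_right_zero) real_asymp
    then have "(\<lambda>n. t * (- e / sqrt (Suc n))) \<longlonglongrightarrow> 0" by simp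
    then have "(\<lambda>n. iexp (t * (- e / sqrt (Suc n)))) \<longlonglongrightarrow> iexp 0"
      by (intro isCont_tendsto_compose[OF isCont_iexp])
    from tendsto_mult[OF this char_clt_tendsto[OF h h0 hv, of t]]
    show "(\<lambda>n. char (distr (replicate_pmf n p) borel (X n)) t) \<longlonglongrightarrow> char (normal_law v) t"
      unfolding eq char_normal_law[OF v0] by simp
  qed
  moreover obtain C where "\<And>x. norm (\<phi> x) \<le> C" using \<phi>(2) by (auto simp: bounded_iff)
  ultimately have "(\<lambda>n. \<integral>x. \<phi> x \<partial>distr (replicate_pmf n p) borel (X n)) \<longlonglongrightarrow> (\<integral>x. \<phi> x \<partial>normal_law v)"
    using \<phi>(1) v0 by (intro weak_conv_imp_integral_bdd_continuous_conv real_distribution_normal_law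
        prob_space.real_distribution_distr[OF measure_pmf.prob_space_axioms]) (auto simp: continuous_on_eq_continuous_at)
  moreover have "\<phi> \<in> borel_measurable borel" using \<phi>(1) by (rule borel_measurable_continuous_onI)
  ultimately show ?thesis by (simp add: integral_distr X_def v_def)
qed

section \<open>Removing one entry of an i.i.d. list\<close>

definition remove_nth :: "nat \<Rightarrow> 'a list \<Rightarrow> 'a list" where
  "remove_nth i xs = take i xs @ drop (Suc i) xs"

lemma mset_remove_nth: "i < length xs \<Longrightarrow> mset xs = add_mset (xs ! i) (mset (remove_nth i xs))"
  by (subst (1) id_take_nth_drop[of i xs]) (auto simp: remove_nth_def)

lemma sum_list_remove_nth:
  "i < length xs \<Longrightarrow> sum_list xs = xs ! i + sum_list (remove_nth i xs)" for xs :: "nat list"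
  using mset_remove_nth[of i xs] by (metis sum_mset.add_mset sum_mset_sum_list)

lemma nth_in_set_remove_nth:
  assumes "i < length xs" "j < length xs" "i \<noteq> j"
  shows "xs ! i \<in> set (remove_nth j xs)"
proof (cases "i < j")
  case True
  then have "xs ! i \<in> set (take j xs)" using assms by (auto simp: in_set_conv_nth intro!: exI[of _ i])
  then show ?thesis by (simp add: remove_nth_def)
next
  case False
  then have "xs ! i \<in> set (drop (Suc j) xs)"
    using assms by (auto simp: in_set_conv_nth intro!: exI[of _ "i - Suc j"])
  then show ?thesis by (simp add: remove_nth_def)
qed

lemma nn_integral_pmf_swap:
  "(\<integral>\<^sup>+x. \<integral>\<^sup>+y. f x y \<partial>measure_pmf q \<partial>measure_pmf p) = (\<integral>\<^sup>+y. \<integral>\<^sup>+x. f x y \<partial>measure_pmf p \<partial>measure_pmf q)"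
proof -
  have "bind_pmf p (\<lambda>x. bind_pmf q (\<lambda>y. return_pmf (x, y))) = bind_pmf q (\<lambda>y. bind_pmf p (\<lambda>x. return_pmf (x, y)))"
    by (rule bind_commute_pmf)
  from arg_cong[OF this, of "\<lambda>r. \<integral>\<^sup>+z. f (fst z) (snd z) \<partial>measure_pmf r"] show ?thesis by simp
qed

lemma nn_integral_replicate_pmf_Suc:
  "(\<integral>\<^sup>+xs. h xs \<partial>replicate_pmf (Suc n) p) = (\<integral>\<^sup>+x. \<integral>\<^sup>+xs. h (x # xs) \<partial>replicate_pmf n p \<partial>p)"
  by simp

text \<open>Each entry of an i.i.d. list is independent of the others. In the induction the head is
  absorbed into the second argument of \<open>h\<close>, which is why \<open>h\<close> is arbitrary,
  and is moved past the removed entry by Fubini.\<close>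

lemma nn_integral_replicate_pmf_nth:
  "i \<le> n \<Longrightarrow> (\<integral>\<^sup>+xs. h (xs ! i) (remove_nth i xs) \<partial>replicate_pmf (Suc n) p) =
     (\<integral>\<^sup>+x. \<integral>\<^sup>+ys. h x ys \<partial>replicate_pmf n p \<partial>p)"
proof (induction n arbitrary: i h)
  case 0
  then show ?case by (simp add: remove_nth_def)
next
  case (Suc n)
  show ?case
  proof (cases i)
    case 0
    then show ?thesis by (simp add: remove_nth_def)
  next
    case (Suc i')
    have "(\<integral>\<^sup>+xs. h (xs ! i) (remove_nth i xs) \<partial>replicate_pmf (Suc (Suc n)) p) =
      (\<integral>\<^sup>+x. \<integral>\<^sup>+xs. h (xs ! i') (x # remove_nth i' xs) \<partial>replicate_pmf (Suc n) p \<partial>p)"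
      by (subst nn_integral_replicate_pmf_Suc) (simp add: Suc remove_nth_def del: replicate_pmf.simps)
    also have "\<dots> = (\<integral>\<^sup>+x. \<integral>\<^sup>+y. \<integral>\<^sup>+zs. h y (x # zs) \<partial>replicate_pmf n p \<partial>p \<partial>p)"
      using Suc.prems Suc by (subst Suc.IH) auto
    also have "\<dots> = (\<integral>\<^sup>+y. \<integral>\<^sup>+x. \<integral>\<^sup>+zs. h y (x # zs) \<partial>replicate_pmf n p \<partial>p \<partial>p)"
      by (rule nn_integral_pmf_swap)
    finally show ?thesis by simp
  qed
qed

lemma nn_integral_replicate_pmf_prod:
  "(\<integral>\<^sup>+xs. prod_list (map f xs) \<partial>replicate_pmf n p) = (\<integral>\<^sup>+x. f x \<partial>measure_pmf p) ^ n"
  by (induction n) (simp_all add: nn_integral_cmult nn_integral_multc)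

text \<open>Counts the possible positions of a distinguished entry; the upper and the lower one-jump
  bound both start from this identity.\<close>

lemma nn_integral_replicate_pmf_sum_nth:
  "(\<integral>\<^sup>+xs. (\<Sum>i\<le>n. h (xs ! i) (remove_nth i xs)) \<partial>replicate_pmf (Suc n) p) =
     of_nat (Suc n) * (\<integral>\<^sup>+x. \<integral>\<^sup>+ys. h x ys \<partial>replicate_pmf n p \<partial>p)"
  by (subst nn_integral_sum) (simp_all add: nn_integral_replicate_pmf_nth del: replicate_pmf.simps)

lemma length_replicate_pmf: "xs \<in> set_pmf (replicate_pmf n p) \<Longrightarrow> length xs = n"
  by (simp add: set_replicate_pmf)

lemma pmf_replicate_pmf:
  "pmf (replicate_pmf n p) xs = (if length xs = n then prod_list (map (pmf p) xs) else 0)"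
proof (induction n arbitrary: xs)
  case 0
  then show ?case by (simp add: pmf_return)
next
  case (Suc n)
  show ?case
  proof (cases xs)
    case Nil
    then have "xs \<notin> set_pmf (replicate_pmf (Suc n) p)" using length_replicate_pmf[of xs "Suc n" p] by auto
    then show ?thesis using Nil by (simp add: pmf_eq_0_set_pmf)
  next
    case (Cons y ys)
    have "ennreal (pmf (replicate_pmf (Suc n) p) xs) = (\<integral>\<^sup>+x. \<integral>\<^sup>+zs. indicator {y} x * indicator {ys} zs \<partial>replicate_pmf n p \<partial>p)"
      unfolding emeasure_pmf_single[symmetric] by (subst nn_integral_indicator[symmetric], simp)
        (auto simp: Cons indicator_def intro!: nn_integral_cong)
    also have "\<dots> = ennreal (pmf p y) * ennreal (pmf (replicate_pmf n p) ys)"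
      by (simp add: nn_integral_cmult nn_integral_multc emeasure_pmf_single)
    finally have "pmf (replicate_pmf (Suc n) p) xs = pmf p y * pmf (replicate_pmf n p) ys"
      by (simp flip: ennreal_mult)
    then show ?thesis using Suc.IH by (simp add: Cons)
  qed
qed

section \<open>Large deviations of heavy-tailed sums\<close>

lemma integrable_measure_pmf_nat_iff:
  fixes f :: "nat \<Rightarrow> real"
  shows "integrable (measure_pmf p) f \<longleftrightarrow> summable (\<lambda>k. pmf p k * \<bar>f k\<bar>)"
  unfolding measure_pmf_eq_density
  by (subst integrable_density) (auto simp: integrable_count_space_nat_iff abs_mult)

lemma expectation_measure_pmf_nat:
  fixes f :: "nat \<Rightarrow> real"
  assumes "integrable (measure_pmf p) f"
  shows "measure_pmf.expectation p f = (\<Sum>k. pmf p k * f k)"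
proof -
  have "integrable (count_space UNIV) (\<lambda>k. pmf p k * f k)"
    using assms by (simp add: integrable_measure_pmf_nat_iff integrable_count_space_nat_iff abs_mult)
  from integral_count_space_nat[OF this] show ?thesis
    unfolding measure_pmf_eq_density by (subst integral_density) auto
qed

text \<open>Markov's inequality for a product of independent factors. The test function is left
  free: if the event excludes entries above some level, it may vanish there, and then no exponential
  moment of \<open>p\<close> is required.\<close>

lemma prob_replicate_pmf_le_prod:
  assumes f: "\<And>x. 0 \<le> f x" "integrable (measure_pmf p) f" "measure_pmf.expectation p f \<le> exp a"
    and A: "\<And>xs. xs \<in> A \<Longrightarrow> length xs = n \<Longrightarrow> 1 \<le> exp d * prod_list (map f xs)"
  shows "measure_pmf.prob (replicate_pmf n p) A \<le> exp (d + real n * a)"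
proof -
  have prod: "ennreal (prod_list (map f xs)) = prod_list (map (\<lambda>x. ennreal (f x)) xs)" for xs
  proof (induction xs)
    case (Cons x xs)
    have "0 \<le> prod_list (map f xs)" using f(1) by (induction xs) auto
    then show ?case using Cons f(1) by (simp add: ennreal_mult)
  qed simp
  have "emeasure (replicate_pmf n p) A = (\<integral>\<^sup>+xs. indicator A xs \<partial>replicate_pmf n p)" by simp
  also have "\<dots> \<le> (\<integral>\<^sup>+xs. ennreal (exp d) * prod_list (map (\<lambda>x. ennreal (f x)) xs) \<partial>replicate_pmf n p)"
  proof (intro nn_integral_mono_AE, simp only: AE_measure_pmf_iff, intro ballI)
    fix xs assume "xs \<in> set_pmf (replicate_pmf n p)"
    then have "length xs = n" by (rule length_replicate_pmf)
    with A[of xs] show "indicator A xs \<le> ennreal (exp d) * prod_list (map (\<lambda>x. ennreal (f x)) xs)"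
      by (auto simp: indicator_def simp flip: prod ennreal_mult')
  qed
  also have "\<dots> = ennreal (exp d) * ennreal (measure_pmf.expectation p f) ^ n"
    using f(1,2) by (simp add: nn_integral_cmult nn_integral_replicate_pmf_prod nn_integral_eq_integral)
  also have "\<dots> \<le> ennreal (exp d) * ennreal (exp a) ^ n"
    using f by (intro mult_left_mono power_mono ennreal_leI) auto
  also have "\<dots> = ennreal (exp (d + real n * a))"
    by (simp add: ennreal_power exp_add exp_of_nat_mult flip: ennreal_mult')
  finally show ?thesis by (simp add: measure_pmf.emeasure_eq_measure)
qed

lemma prob_replicate_pmf_ex_le:
  "measure_pmf.prob (replicate_pmf n p) {xs. \<exists>x\<in>set xs. P x} \<le> real n * measure_pmf.prob p {x. P x}"
proof -
  have "emeasure (replicate_pmf n p) {xs. \<exists>x\<in>set xs. P x} \<le> of_nat n * emeasure p {x. P x}"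
  proof (induction n)
    case (Suc n)
    let ?A = "{xs. \<exists>x\<in>set xs. P x}"
    have "emeasure (replicate_pmf (Suc n) p) ?A = (\<integral>\<^sup>+x. \<integral>\<^sup>+xs. indicator ?A (x # xs) \<partial>replicate_pmf n p \<partial>p)"
      by (simp add: nn_integral_replicate_pmf_Suc flip: nn_integral_indicator del: replicate_pmf.simps)
    also have "\<dots> \<le> (\<integral>\<^sup>+x. \<integral>\<^sup>+xs. indicator {x. P x} x + indicator ?A xs \<partial>replicate_pmf n p \<partial>p)"
      by (intro nn_integral_mono) (auto simp: indicator_def)
    also have "\<dots> = emeasure p {x. P x} + emeasure (replicate_pmf n p) ?A"
      by (simp add: nn_integral_add measure_pmf.emeasure_space_1)
    also have "\<dots> \<le> emeasure p {x. P x} + of_nat n * emeasure p {x. P x}"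
      by (intro add_left_mono Suc.IH)
    finally show ?case by (simp add: distrib_right)
  qed simp
  then show ?thesis
    by (simp add: measure_pmf.emeasure_eq_measure ennreal_of_nat_eq_real_of_nat flip: ennreal_mult')
qed

text \<open>Times the quadratic Taylor minorant of \<open>exp y\<close>, the right-hand side equals
  1 + (y^2 + y^3 + y^4)/2. As \<open>y\<close> has no upper limit, the tilt in the lower tail bound
  is unrestricted.\<close>

lemma exp_minus_le: "0 \<le> y \<Longrightarrow> exp (- y) \<le> 1 - y + y\<^sup>2" for y :: real
proof -
  assume y: "0 \<le> y"
  have "1 \<le> (1 - y + y\<^sup>2) * (1 + y + y\<^sup>2 / 2)"
  proof -
    have "(1 - y + y\<^sup>2) * (1 + y + y\<^sup>2 / 2) = 1 + (y^2 + y^3 + y^4) / 2"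
      by (simp add: power2_eq_square power3_eq_cube power4_eq_xxxx field_simps)
    then show ?thesis using y by simp
  qed
  also have "\<dots> \<le> (1 - y + y\<^sup>2) * exp y"
  proof (intro mult_left_mono)
    show "1 + y + y\<^sup>2 / 2 \<le> exp y" using y by (rule exp_lower_Taylor_quadratic)
    have "0 \<le> (y - 1/2)\<^sup>2" by simp
    then show "0 \<le> 1 - y + y\<^sup>2" by (simp add: power2_eq_square algebra_simps)
  qed
  finally show ?thesis by (simp add: exp_minus divide_simps mult.commute)
qed

text \<open>Truncating nonnegative entries only lowers their sum, and a high enough truncation keeps
  the mean above \<theta>. This reduces the claim to bounded entries, for which a Chernoff bound
  decays geometrically.\<close>

lemma wlln_lower:
  fixes p :: "nat pmf"
  assumes int: "integrable (measure_pmf p) real" and \<theta>: "\<theta> < measure_pmf.expectation p real"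
  shows "(\<lambda>n. measure_pmf.prob (replicate_pmf n p) {xs. real (sum_list xs) \<le> \<theta> * real n}) \<longlonglongrightarrow> 0"
proof -
  define t where "t K x = (if x < K then real x else 0)" for K x :: nat
  have "(\<lambda>K. measure_pmf.expectation p (t K)) \<longlonglongrightarrow> measure_pmf.expectation p real"
  proof (rule integral_dominated_convergence[where w=real])
    show "AE x in measure_pmf p. (\<lambda>K. t K x) \<longlonglongrightarrow> real x"
    proof (rule AE_I2)
      fix x
      have "\<forall>\<^sub>F K in sequentially. t K x = real x"
        using eventually_gt_at_top[of x] by eventually_elim (simp add: t_def)
      then show "(\<lambda>K. t K x) \<longlonglongrightarrow> real x" by (rule tendsto_eventually)
    qed
  qed (auto simp: int t_def)
  then have "\<forall>\<^sub>F K in sequentially. measure_pmf.expectation p (t K) > \<theta>"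
    using \<theta> by (rule order_tendstoD)
  then obtain K where K: "measure_pmf.expectation p (t (Suc K)) > \<theta>"
    by (auto simp: eventually_sequentially) (meson le_SucI le_refl)
  define g where "g = t (Suc K)"
  define e where "e = measure_pmf.expectation p g"
  \<comment> \<open>The minimiser of
    \<open>- s * (e - \<theta>) + s\<^sup>2 * (real K + 1)\<^sup>2\<close>, the exponent per entry,
    which is negative there.\<close>
  define s where "s = (e - \<theta>) / (2 * (real K + 1)\<^sup>2)"
  have e: "e > \<theta>" using K by (simp add: e_def g_def)
  have s: "s > 0" using e by (simp add: s_def)
  have g: "0 \<le> g x" "g x \<le> real K + 1" "g x \<le> real x" for x by (auto simp: g_def t_def)
  have intg: "integrable (measure_pmf p) g" using g by (intro measure_pmf.integrable_const_bound[where B="real K + 1"]) auto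
  define a where "a = - s * e + s\<^sup>2 * (real K + 1)\<^sup>2"
  have bound: "measure_pmf.prob (replicate_pmf n p) {xs. real (sum_list xs) \<le> \<theta> * real n} \<le> exp (s * \<theta> * real n + real n * a)" for n
  proof (rule prob_replicate_pmf_le_prod[where f="\<lambda>x. exp (- s * g x)"])
    show int': "integrable (measure_pmf p) (\<lambda>x. exp (- s * g x))"
      using s g by (intro measure_pmf.integrable_const_bound[where B=1]) auto
    have "measure_pmf.expectation p (\<lambda>x. exp (- s * g x)) \<le> measure_pmf.expectation p (\<lambda>x. (1 + s\<^sup>2 * (real K + 1)\<^sup>2) - s * g x)"
    proof (rule integral_mono)
      fix x
      have "exp (- s * g x) \<le> 1 - s * g x + (s * g x)\<^sup>2" using exp_minus_le[of "s * g x"] s g by simp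
      also have "(s * g x)\<^sup>2 \<le> s\<^sup>2 * (real K + 1)\<^sup>2"
        unfolding power_mult_distrib using g by (intro mult_left_mono power_mono) auto
      finally show "exp (- s * g x) \<le> (1 + s\<^sup>2 * (real K + 1)\<^sup>2) - s * g x" by simp
    qed (use int' intg in auto)
    also have "\<dots> = 1 + a" using intg by (simp add: e_def a_def)
    also have "\<dots> \<le> exp a" by (rule exp_ge_add_one_self)
    finally show "measure_pmf.expectation p (\<lambda>x. exp (- s * g x)) \<le> exp a" .
  next
    fix xs :: "nat list" assume xs: "xs \<in> {xs. real (sum_list xs) \<le> \<theta> * real n}" "length xs = n"
    have "prod_list (map (\<lambda>x. exp (- s * g x)) xs) = exp (- s * sum_list (map g xs))"
      by (induction xs) (auto simp: algebra_simps exp_add exp_diff exp_minus field_simps)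
    moreover have "sum_list (map g xs) \<le> real (sum_list xs)"
      using g(3) by (induction xs) (auto intro: add_mono)
    then have "s * sum_list (map g xs) \<le> s * (\<theta> * real n)" using xs s by (intro mult_left_mono) auto
    ultimately show "1 \<le> exp (s * \<theta> * real n) * prod_list (map (\<lambda>x. exp (- s * g x)) xs)"
      by (simp add: mult.assoc flip: exp_add)
  qed auto
  define q where "q = exp (s * \<theta> + a)"
  have "s * \<theta> + a = - (s * ((e - \<theta>) - s * (real K + 1)\<^sup>2))"
    by (simp add: a_def power2_eq_square algebra_simps)
  also have "s * (real K + 1)\<^sup>2 = (e - \<theta>) / 2" by (simp add: s_def field_simps)
  finally have "s * \<theta> + a < 0" using s e by simp
  then have q: "0 \<le> q" "q < 1" by (auto simp: q_def)
  have "exp (s * \<theta> * real n + real n * a) = q ^ n" for n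
    by (simp add: q_def algebra_simps flip: exp_of_nat_mult)
  then have le: "measure_pmf.prob (replicate_pmf n p) {xs. real (sum_list xs) \<le> \<theta> * real n} \<le> q ^ n" for n
    using bound[of n] by simp
  show ?thesis
    by (rule tendsto_sandwich[OF _ _ tendsto_const LIMSEQ_power_zero[of q]]) (use le q in auto)
qed

section \<open>Truncated tails and local one-jump estimates for a heavy-tailed law\<close>

locale heavy_tail =
  fixes p :: "nat pmf" and c \<beta> m :: real
  assumes c_pos: "c > 0" and \<beta>: "\<beta> > 2" and m_less_1: "m < 1"
    and tail: "pmf p \<sim>[at_top] (\<lambda>k. c * real k powr (- \<beta>))"
    and integrable_id: "integrable (measure_pmf p) real"
    and mean: "measure_pmf.expectation p real = m"
begin

abbreviation "walk n \<equiv> measure_pmf (replicate_pmf n p)"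

lemma mean_nonneg: "0 \<le> m"
  unfolding mean[symmetric] by simp

lemma pmf_le: "l > 1 \<Longrightarrow> \<forall>\<^sub>F k in at_top. pmf p k \<le> l * (c * real k powr (- \<beta>))"
  using asymp_equiv_imp_eventually_le[OF tail, of l] c_pos by simp

lemma pmf_ge: "l < 1 \<Longrightarrow> \<forall>\<^sub>F k in at_top. pmf p k \<ge> l * (c * real k powr (- \<beta>))"
  using asymp_equiv_imp_eventually_ge[OF tail, of l] c_pos by simp

text \<open>The order \<beta>/2 lies strictly between 1 and \<beta> - 1 because \<beta> > 2: small
  enough for the moment to be finite, large enough for Markov's inequality to beat a union over n
  entries.\<close>

definition "moment = measure_pmf.expectation p (\<lambda>x. real x powr (\<beta> / 2))"

lemma integrable_moment: "integrable (measure_pmf p) (\<lambda>x. real x powr (\<beta> / 2))"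
  unfolding integrable_measure_pmf_nat_iff
proof (rule summable_comparison_test_ev)
  show "\<forall>\<^sub>F k in sequentially. norm (pmf p k * \<bar>real k powr (\<beta> / 2)\<bar>) \<le> 2 * c * real k powr (- (\<beta> / 2))"
    using pmf_le[of 2, simplified] eventually_gt_at_top[of 0]
  proof eventually_elim
    case (elim k)
    have "pmf p k * real k powr (\<beta> / 2) \<le> 2 * (c * real k powr (- \<beta>)) * real k powr (\<beta> / 2)"
      using elim by (intro mult_right_mono) auto
    also have "\<dots> = 2 * c * real k powr (- (\<beta> / 2))"
      by (simp add: mult.assoc flip: powr_add)
    finally show ?case by simp
  qed
  show "summable (\<lambda>k. 2 * c * real k powr (- (\<beta> / 2)))"
    using \<beta> by (intro summable_mult) (simp add: summable_real_powr_iff)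
qed

lemma prob_gt_le:
  assumes "u > 0"
  shows "measure_pmf.prob p {x. real x > u} \<le> moment / u powr (\<beta> / 2)"
proof -
  have "measure_pmf.prob p {x. real x > u} = measure_pmf.expectation p (indicator {x. real x > u})" by simp
  also have "\<dots> \<le> measure_pmf.expectation p (\<lambda>x. real x powr (\<beta> / 2) / u powr (\<beta> / 2))"
  proof (rule integral_mono)
    fix x
    show "indicator {x. real x > u} x \<le> real x powr (\<beta> / 2) / u powr (\<beta> / 2)"
      using assms \<beta> by (auto simp: indicator_def intro!: powr_mono2)
  next
    show "integrable (measure_pmf p) (\<lambda>x. real x powr (\<beta> / 2) / u powr (\<beta> / 2))"
      using integrable_moment by simp
  qed (auto intro!: measure_pmf.integrable_const_bound[where B=1])
  finally show ?thesis by (simp add: moment_def)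
qed

text \<open>A union bound with a moment of order above 1. It makes a second large entry unlikely, so
  that the jump can be singled out in the lower bound.\<close>

lemma max_tendsto_0:
  assumes \<epsilon>: "\<epsilon> > 0"
  shows "(\<lambda>n. measure_pmf.prob (replicate_pmf n p) {xs. \<exists>x\<in>set xs. real x > \<epsilon> * real n}) \<longlonglongrightarrow> 0"
proof (rule tendsto_sandwich[OF _ _ tendsto_const])
  show "\<forall>\<^sub>F n in sequentially. measure_pmf.prob (replicate_pmf n p) {xs. \<exists>x\<in>set xs. real x > \<epsilon> * real n}
    \<le> moment / \<epsilon> powr (\<beta> / 2) * real n powr (1 - \<beta> / 2)"
    using eventually_gt_at_top[of 0]
  proof eventually_elim
    case (elim n)
    have "measure_pmf.prob (replicate_pmf n p) {xs. \<exists>x\<in>set xs. real x > \<epsilon> * real n} \<le>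
      real n * (moment / (\<epsilon> * real n) powr (\<beta> / 2))"
      using elim \<epsilon> by (intro order_trans[OF prob_replicate_pmf_ex_le] mult_left_mono prob_gt_le) auto
    also have "\<dots> = moment / \<epsilon> powr (\<beta> / 2) * real n powr (1 - \<beta> / 2)"
      using elim \<epsilon> by (simp add: powr_mult powr_diff)
    finally show ?case .
  qed
  have "(\<lambda>n. real n powr (1 - \<beta> / 2)) \<longlonglongrightarrow> 0"
    using \<beta> by (intro tendsto_neg_powr filterlim_real_sequentially) simp
  from tendsto_mult_right_zero[OF this]
  show "(\<lambda>n. moment / \<epsilon> powr (\<beta> / 2) * real n powr (1 - \<beta> / 2)) \<longlonglongrightarrow> 0" .
qed simp

text \<open>Where \<open>s * x\<close> is at most \<eta>, the quadratic bound on the exponential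
  applies and its square term goes into the factor \<open>1 + \<eta>\<close>, so the mean enters
  almost sharply. Where \<open>s * x\<close> exceeds \<eta>, the exponential is at most
  \<open>exp (s * b)\<close>, and the power of \<open>s * x / \<eta>\<close> is at least 1.\<close>

lemma truncated_exp_le:
  assumes s: "s \<ge> 0" and \<eta>: "0 < \<eta>" "\<eta> \<le> 1"
  shows "(if real x \<le> b then exp (s * real x) else 0) \<le>
    1 + (1 + \<eta>) * s * real x + exp (s * b) * (s / \<eta>) powr (\<beta> / 2) * real x powr (\<beta> / 2)"
proof -
  have eq: "(s / \<eta>) powr (\<beta> / 2) * real x powr (\<beta> / 2) = (s * real x / \<eta>) powr (\<beta> / 2)"
    using s \<eta> by (subst powr_mult[symmetric]) auto
  have nonneg: "0 \<le> (1 + \<eta>) * s * real x" "0 \<le> exp (s * b) * (s * real x / \<eta>) powr (\<beta> / 2)"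
    using s \<eta> by auto
  consider "real x > b" | "real x \<le> b" "s * real x \<le> \<eta>" | "real x \<le> b" "s * real x > \<eta>" by linarith
  then show ?thesis
  proof cases
    case 1
    then show ?thesis using nonneg by (simp add: mult.assoc eq)
  next
    case 2
    define y where "y = s * real x"
    have y: "0 \<le> y" "y \<le> \<eta>" using s 2 by (auto simp: y_def)
    then have "exp y \<le> 1 + y + y\<^sup>2" using \<eta> by (intro exp_bound) auto
    also have "y\<^sup>2 \<le> \<eta> * y" using y by (simp add: power2_eq_square mult_right_mono)
    finally have "exp y \<le> 1 + (1 + \<eta>) * y" by (simp add: algebra_simps)
    then have "exp (s * real x) \<le> 1 + (1 + \<eta>) * (s * real x) + exp (s * b) * ((s / \<eta>) powr (\<beta> / 2) * real x powr (\<beta> / 2))"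
      unfolding eq y_def using nonneg(2) by linarith
    then show ?thesis using 2(1) by (simp add: mult.assoc)
  next
    case 3
    then have "1 \<le> (s * real x / \<eta>) powr (\<beta> / 2)" using \<eta> \<beta> by (intro ge_one_powr_ge_zero) auto
    moreover have "exp (s * real x) \<le> exp (s * b)" using 3 s by (simp add: mult_left_mono)
    ultimately have "exp (s * real x) \<le> exp (s * b) * (s * real x / \<eta>) powr (\<beta> / 2)"
      by (metis exp_ge_zero mult.right_neutral mult_left_mono order_trans)
    then show ?thesis using 3 nonneg(1) by (simp add: mult.assoc eq)
  qed
qed

lemma truncated_chernoff:
  assumes s: "s \<ge> 0" and \<eta>: "0 < \<eta>" "\<eta> \<le> 1" and b: "b \<ge> 0"
  shows "measure_pmf.prob (replicate_pmf n p) {xs. \<theta> * real n \<le> real (sum_list xs) \<and> (\<forall>x\<in>set xs. real x \<le> b)}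
    \<le> exp (- s * \<theta> * real n + real n * ((1 + \<eta>) * s * m + exp (s * b) * (s / \<eta>) powr (\<beta> / 2) * moment))"
proof (rule prob_replicate_pmf_le_prod[where f="\<lambda>x. if real x \<le> b then exp (s * real x) else 0"])
  let ?f = "\<lambda>x. if real x \<le> b then exp (s * real x) else 0"
  show int: "integrable (measure_pmf p) ?f"
    using s b by (intro measure_pmf.integrable_const_bound[where B="exp (s * b)"]) (auto intro: mult_left_mono)
  have "measure_pmf.expectation p ?f \<le> measure_pmf.expectation p
    (\<lambda>x. 1 + (1 + \<eta>) * s * real x + exp (s * b) * (s / \<eta>) powr (\<beta> / 2) * real x powr (\<beta> / 2))"
    using int integrable_id integrable_moment by (intro integral_mono truncated_exp_le[OF s \<eta>]) auto
  also have "\<dots> = 1 + ((1 + \<eta>) * s * m + exp (s * b) * (s / \<eta>) powr (\<beta> / 2) * moment)"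
    using integrable_id integrable_moment by (simp add: mean moment_def)
  also have "\<dots> \<le> exp ((1 + \<eta>) * s * m + exp (s * b) * (s / \<eta>) powr (\<beta> / 2) * moment)"
    by (rule exp_ge_add_one_self)
  finally show "measure_pmf.expectation p ?f \<le> \<dots>" .
next
  fix xs :: "nat list"
  assume xs: "xs \<in> {xs. \<theta> * real n \<le> real (sum_list xs) \<and> (\<forall>x\<in>set xs. real x \<le> b)}"
  then have "\<forall>x\<in>set xs. real x \<le> b" by simp
  then have "prod_list (map (\<lambda>x. if real x \<le> b then exp (s * real x) else 0) xs) = exp (s * real (sum_list xs))"
    by (induction xs) (auto simp: algebra_simps exp_add)
  moreover have "s * (\<theta> * real n) \<le> s * real (sum_list xs)" using xs s by (intro mult_left_mono) auto
  ultimately show "1 \<le> exp (- s * \<theta> * real n) * prod_list (map (\<lambda>x. if real x \<le> b then exp (s * real x) else 0) xs)"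
    by (simp add: mult.assoc flip: exp_add)
qed auto

text \<open>Exponential tilting by \<open>a ln n / n\<close>: the truncation level is so small that the
  tilted moment generating function is governed by its linear term.\<close>
lemma truncated_upper_tail:
  assumes \<theta>: "\<theta> > m"
  shows "\<exists>\<epsilon>>0. \<forall>\<^sub>F n in sequentially. measure_pmf.prob (replicate_pmf n p)
    {xs. \<theta> * real n \<le> real (sum_list xs) \<and> (\<forall>x\<in>set xs. real x \<le> \<epsilon> * real n)} \<le> real n powr (- \<gamma>)"
proof -
  \<comment> \<open>Keeps \<open>(1 + \<eta>) * m\<close> at or below the midpoint of
    \<open>m\<close> and \<theta>; the denominator \<open>m + 1\<close> guards against
    \<open>m = 0\<close>.\<close>
  define \<eta> where "\<eta> = min 1 ((\<theta> - m) / (2 * (m + 1)))"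
  \<comment> \<open>Half the gap \<open>\<theta> - m\<close> times \<open>a\<close> is |\<gamma>| +
    1. The tilt thus gives n^(-|\<gamma>| - 1), and the spare factor 1/n absorbs the error term,
    which is below 1 and hence below \<open>ln n\<close> from n = 3 on.\<close>
  define a where "a = 2 * (\<bar>\<gamma>\<bar> + 1) / (\<theta> - m)"
  define r where "r = \<beta> / 2"
  \<comment> \<open>At this truncation level the tilt is at most n^((r - 1)/2), so the error term is
    of order n n^((r - 1)/2) (ln n / n)^r = (ln n)^r n^(-(r - 1)/2).\<close>
  define \<epsilon> where "\<epsilon> = (r - 1) / (2 * a)"
  have r: "r > 1" using \<beta> by (simp add: r_def)
  have \<eta>: "0 < \<eta>" "\<eta> \<le> 1" using \<theta> mean_nonneg by (auto simp: \<eta>_def)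
  have "\<eta> * m \<le> \<eta> * (m + 1)" using \<eta> by simp
  also have "\<dots> \<le> (\<theta> - m) / (2 * (m + 1)) * (m + 1)"
    using mean_nonneg by (intro mult_right_mono) (auto simp: \<eta>_def)
  also have "\<dots> = (\<theta> - m) / 2" using mean_nonneg by (simp add: field_simps)
  finally have \<eta>m: "\<eta> * m \<le> (\<theta> - m) / 2" .
  have a: "a > 0" using \<theta> by (simp add: a_def)
  have \<epsilon>: "\<epsilon> > 0" using r a by (simp add: \<epsilon>_def)
  define K where "K = (a / \<eta>) powr r * moment"
  have "(\<lambda>n. K * (ln (real n) powr r * real n powr (- ((r - 1) / 2)))) \<longlonglongrightarrow> K * 0"
    using r by (intro tendsto_mult_left) real_asymp
  then have "\<forall>\<^sub>F n in sequentially. K * (ln (real n) powr r * real n powr (- ((r - 1) / 2))) < 1"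
    by (intro order_tendstoD(2)) auto
  then have "\<forall>\<^sub>F n in sequentially. measure_pmf.prob (replicate_pmf n p)
    {xs. \<theta> * real n \<le> real (sum_list xs) \<and> (\<forall>x\<in>set xs. real x \<le> \<epsilon> * real n)} \<le> real n powr (- \<gamma>)"
    using eventually_ge_at_top[of 3]
  proof eventually_elim
    case (elim n)
    define L where "L = ln (real n)"
    have n: "real n > 0" using elim by simp
    have "exp 1 \<le> real n" using elim exp_le by linarith
    then have L: "L \<ge> 1" using n by (simp add: L_def ln_ge_iff)
    define s where "s = a * L / real n"
    have s: "s \<ge> 0" using a L n by (simp add: s_def)
    have "exp (s * (\<epsilon> * real n)) = real n powr ((r - 1) / 2)"
      using n a by (simp add: s_def \<epsilon>_def powr_def L_def)
    moreover have "(s / \<eta>) powr r = (a / \<eta>) powr r * L powr r * real n powr (- r)"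
    proof -
      have "s / \<eta> = (a / \<eta>) * L / real n" by (simp add: s_def)
      then show ?thesis using a \<eta> L n by (simp only: powr_divide powr_mult powr_minus_divide) simp
    qed
    ultimately have "real n * (exp (s * (\<epsilon> * real n)) * (s / \<eta>) powr r * moment) =
      K * (L powr r * (real n powr 1 * real n powr ((r - 1) / 2) * real n powr (- r)))"
      using n by (simp add: K_def)
    also have "real n powr 1 * real n powr ((r - 1) / 2) * real n powr (- r) = real n powr (- ((r - 1) / 2))"
      unfolding powr_add[symmetric] by (rule arg_cong[where f="\<lambda>z. real n powr z"]) (simp add: field_simps)
    finally have small: "real n * (exp (s * (\<epsilon> * real n)) * (s / \<eta>) powr r * moment) < 1"
      using elim(1) by (simp add: L_def)
    have "measure_pmf.prob (replicate_pmf n p)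
      {xs. \<theta> * real n \<le> real (sum_list xs) \<and> (\<forall>x\<in>set xs. real x \<le> \<epsilon> * real n)} \<le>
      exp (- s * \<theta> * real n + real n * ((1 + \<eta>) * s * m + exp (s * (\<epsilon> * real n)) * (s / \<eta>) powr (\<beta> / 2) * moment))"
      using \<epsilon> n by (intro truncated_chernoff s \<eta>) simp
    also have "\<dots> = exp (- (a * L * (\<theta> - (1 + \<eta>) * m)) + real n * (exp (s * (\<epsilon> * real n)) * (s / \<eta>) powr r * moment))"
    proof -
      have "s * real n = a * L" using n by (simp add: s_def)
      then have "- s * \<theta> * real n + real n * ((1 + \<eta>) * s * m) = - (a * L * (\<theta> - (1 + \<eta>) * m))"
        by (simp add: algebra_simps)
      then show ?thesis by (simp add: distrib_left r_def add.assoc[symmetric])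
    qed
    also have "\<dots> \<le> exp (- (\<gamma> * L))"
    proof -
      have "a * L * ((\<theta> - m) / 2) \<le> a * L * (\<theta> - (1 + \<eta>) * m)"
      proof (intro mult_left_mono)
        show "(\<theta> - m) / 2 \<le> \<theta> - (1 + \<eta>) * m" 
          using \<eta>m by (simp add: distrib_right field_simps)
      qed (use a L in simp)
      moreover have "a * L * ((\<theta> - m) / 2) = \<bar>\<gamma>\<bar> * L + L" using \<theta> by (simp add: a_def field_simps)
      moreover have "\<gamma> * L \<le> \<bar>\<gamma>\<bar> * L" using L by (intro mult_right_mono) auto
      ultimately show ?thesis unfolding exp_le_cancel_iff using small L by linarith
    qed
    also have "\<dots> = real n powr (- \<gamma>)" using n by (simp add: powr_def L_def)
    finally show ?case .
  qed
  with \<epsilon> show ?thesis by blast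
qed

text \<open>Either some entry exceeds a small multiple of \<open>n\<close>, which the union bound
  makes unlikely, or the truncated tail bound applies. Any positive exponent would do there; it is
  taken to be 1.\<close>

lemma wlln_upper:
  assumes \<theta>: "\<theta> > m"
  shows "(\<lambda>n. measure_pmf.prob (replicate_pmf n p) {xs. \<theta> * real n \<le> real (sum_list xs)}) \<longlonglongrightarrow> 0"
proof -
  obtain \<epsilon> where \<epsilon>: "\<epsilon> > 0" and ev: "\<forall>\<^sub>F n in sequentially. measure_pmf.prob (replicate_pmf n p)
    {xs. \<theta> * real n \<le> real (sum_list xs) \<and> (\<forall>x\<in>set xs. real x \<le> \<epsilon> * real n)} \<le> real n powr (- 1)"
    using truncated_upper_tail[OF \<theta>, of 1] by blast
  show ?thesis
  proof (rule tendsto_sandwich[OF _ _ tendsto_const])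
    show "\<forall>\<^sub>F n in sequentially. measure_pmf.prob (replicate_pmf n p) {xs. \<theta> * real n \<le> real (sum_list xs)} \<le>
      real n powr (- 1) + measure_pmf.prob (replicate_pmf n p) {xs. \<exists>x\<in>set xs. real x > \<epsilon> * real n}"
      using ev
    proof eventually_elim
      case (elim n)
      have "measure_pmf.prob (replicate_pmf n p) {xs. \<theta> * real n \<le> real (sum_list xs)} \<le>
        measure_pmf.prob (replicate_pmf n p) ({xs. \<theta> * real n \<le> real (sum_list xs) \<and> (\<forall>x\<in>set xs. real x \<le> \<epsilon> * real n)}
         \<union> {xs. \<exists>x\<in>set xs. real x > \<epsilon> * real n})"
        by (intro measure_pmf.finite_measure_mono) (auto simp: not_less)
      also have "\<dots> \<le> measure_pmf.prob (replicate_pmf n p) {xs. \<theta> * real n \<le> real (sum_list xs) \<and> (\<forall>x\<in>set xs. real x \<le> \<epsilon> * real n)}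
        + measure_pmf.prob (replicate_pmf n p) {xs. \<exists>x\<in>set xs. real x > \<epsilon> * real n}"
        by (rule measure_Un_le) auto
      finally show ?case using elim by linarith
    qed
    have "(\<lambda>n. real n powr (- 1)) \<longlonglongrightarrow> 0"
      by (intro tendsto_neg_powr filterlim_real_sequentially) simp
    from tendsto_add[OF this max_tendsto_0[OF \<epsilon>]]
    show "(\<lambda>n. real n powr (- 1) + measure_pmf.prob (replicate_pmf n p) {xs. \<exists>x\<in>set xs. real x > \<epsilon> * real n}) \<longlonglongrightarrow> 0"
      by simp
  qed simp
qed

text \<open>The asymptotic order of the probability that \<open>n + 1\<close> variables sum up to \<open>n\<close>:
  one of them is about \<open>(1 - m) n\<close>.\<close>
definition jump_rate :: "nat \<Rightarrow> real" where
  "jump_rate n = real (Suc n) * (c * ((1 - m) * real n) powr (- \<beta>))"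

lemma jump_rate_pos: "n > 0 \<Longrightarrow> jump_rate n > 0"
  using c_pos m_less_1 by (simp add: jump_rate_def)

text \<open>Converts tail values at \<open>x n\<close> into units of the tail at
  \<open>(1 - m) n\<close>, the typical size of the jump.\<close>

lemma powr_scaled:
  assumes "x > 0"
  shows "c * (x * real n) powr (- \<beta>) = ((1 - m) / x) powr \<beta> * (c * ((1 - m) * real n) powr (- \<beta>))"
proof -
  define d where "d = 1 - m"
  have "d > 0" using m_less_1 by (simp add: d_def)
  then show ?thesis
    unfolding d_def[symmetric] using assms by (simp add: powr_mult powr_divide powr_minus field_simps)
qed

text \<open>A union bound over the position of an entry above \<open>b\<close>. Given the other
  \<open>n\<close> entries the jump must equal \<open>n - sum_list ys\<close>, so integrating it out
  leaves an atom of \<open>p\<close>. Lists with several large entries are overcounted, which is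
  harmless for an upper bound.\<close>

lemma prob_le_no_jump_plus_jump:
  "measure_pmf.prob (replicate_pmf (Suc n) p) {xs. sum_list xs = n} \<le>
     measure_pmf.prob (replicate_pmf (Suc n) p) {xs. sum_list xs = n \<and> (\<forall>x\<in>set xs. real x \<le> b)} +
     real (Suc n) * measure_pmf.expectation (replicate_pmf n p)
       (\<lambda>ys. if sum_list ys \<le> n \<and> b < real (n - sum_list ys) then pmf p (n - sum_list ys) else 0)"
  (is "_ \<le> ?P + _ * measure_pmf.expectation _ ?G")
proof -
  define H :: "nat \<Rightarrow> nat list \<Rightarrow> ennreal" where
    "H x ys = (if b < real x \<and> x + sum_list ys = n then 1 else 0)" for x ys
  have G: "(\<integral>\<^sup>+x. H x ys \<partial>p) = ennreal (?G ys)" for ys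
  proof -
    have "(\<integral>\<^sup>+x. H x ys \<partial>p) = (\<integral>\<^sup>+x. (if sum_list ys \<le> n \<and> b < real (n - sum_list ys) then 1 else 0) * indicator {n - sum_list ys} x \<partial>p)"
      by (intro nn_integral_cong) (auto simp: H_def indicator_def)
    then show ?thesis by (auto simp: nn_integral_cmult emeasure_pmf_single)
  qed
  have int: "integrable (walk n) ?G"
    by (intro measure_pmf.integrable_const_bound[where B=1]) (auto simp: pmf_le_1)
  have "emeasure (walk (Suc n)) {xs. sum_list xs = n} = (\<integral>\<^sup>+xs. indicator {xs. sum_list xs = n} xs \<partial>walk (Suc n))"
    by simp
  also have "\<dots> \<le> (\<integral>\<^sup>+xs. indicator {xs. sum_list xs = n \<and> (\<forall>x\<in>set xs. real x \<le> b)} xs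
    + (\<Sum>i\<le>n. H (xs ! i) (remove_nth i xs)) \<partial>walk (Suc n))"
  proof (intro nn_integral_mono_AE, simp only: AE_measure_pmf_iff, intro ballI)
    fix xs assume "xs \<in> set_pmf (replicate_pmf (Suc n) p)"
    then have len: "length xs = Suc n" by (rule length_replicate_pmf)
    show "indicator {xs. sum_list xs = n} xs \<le> (indicator {xs. sum_list xs = n \<and> (\<forall>x\<in>set xs. real x \<le> b)} xs
      + (\<Sum>i\<le>n. H (xs ! i) (remove_nth i xs)) :: ennreal)"
    proof (cases "sum_list xs = n \<and> (\<exists>x\<in>set xs. b < real x)")
      case True
      then obtain i where i: "i \<le> n" "b < real (xs ! i)" using len by (auto simp: in_set_conv_nth less_Suc_eq_le)
      then have "H (xs ! i) (remove_nth i xs) = 1"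
        using True len sum_list_remove_nth[of i xs] by (simp add: H_def)
      then have "1 \<le> (\<Sum>i\<le>n. H (xs ! i) (remove_nth i xs))"
        using i member_le_sum[of i "{..n}" "\<lambda>i. H (xs ! i) (remove_nth i xs)"] by (simp del: sum.atMost_Suc)
      then show ?thesis by (simp add: indicator_def add_increasing del: sum.atMost_Suc)
    next
      case False
      then show ?thesis by (auto simp: indicator_def not_less)
    qed
  qed
  also have "\<dots> = emeasure (walk (Suc n)) {xs. sum_list xs = n \<and> (\<forall>x\<in>set xs. real x \<le> b)}
    + of_nat (Suc n) * (\<integral>\<^sup>+x. \<integral>\<^sup>+ys. H x ys \<partial>walk n \<partial>p)"
    by (subst nn_integral_add) (simp_all add: nn_integral_replicate_pmf_sum_nth del: replicate_pmf.simps of_nat_Suc sum.atMost_Suc)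
  also have "(\<integral>\<^sup>+x. \<integral>\<^sup>+ys. H x ys \<partial>walk n \<partial>p) = (\<integral>\<^sup>+ys. ennreal (?G ys) \<partial>walk n)"
    unfolding G[symmetric] by (rule nn_integral_pmf_swap)
  also have "\<dots> = ennreal (measure_pmf.expectation (replicate_pmf n p) ?G)"
    using int by (intro nn_integral_eq_integral) auto
  finally have "ennreal (measure_pmf.prob (replicate_pmf (Suc n) p) {xs. sum_list xs = n}) \<le>
    ennreal (?P + real (Suc n) * measure_pmf.expectation (replicate_pmf n p) ?G)"
    by (simp add: measure_pmf.emeasure_eq_measure ennreal_of_nat_eq_real_of_nat ennreal_mult ennreal_plus
        integral_nonneg_AE del: replicate_pmf.simps of_nat_Suc)
  then show ?thesis
    by (subst (asm) ennreal_le_iff) (auto intro!: add_nonneg_nonneg mult_nonneg_nonneg integral_nonneg_AE)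
qed

text \<open>Three contributions: no jump, smaller than the rate by a factor of order n; a jump after
  an atypically large remainder, whose atom has the right order but whose probability vanishes; and
  a jump after a typical remainder, whose atom is sharp up to powers of \<open>l\<close>.\<close>

lemma local_upper_bound:
  assumes e: "e > 0"
  shows "\<forall>\<^sub>F n in sequentially. measure_pmf.prob (replicate_pmf (Suc n) p) {xs. sum_list xs = n} \<le> (1 + e) * jump_rate n"
proof -
  \<comment> \<open>One factor \<open>l\<close> is lost in the asymptotics of the atoms and
    \<open>l powr \<beta>\<close> in admitting jumps of size \<open>\<kappa> n\<close> instead of
    \<open>(1 - m) n\<close>. Their product is set to \<open>1 + e / 2\<close>, and the other
    \<open>e / 2\<close> is left for \<open>err\<close>.\<close>
  define l where "l = (1 + e / 2) powr (1 / (\<beta> + 1))"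
  have l: "l > 1" using e \<beta> unfolding l_def by (intro gr_one_powr) auto
  have l_powr: "l * l powr \<beta> = 1 + e / 2"
  proof -
    have "l * l powr \<beta> = l powr (\<beta> + 1)" using l by (simp add: powr_add)
    also have "\<dots> = 1 + e / 2" using e \<beta> by (simp add: l_def powr_powr)
    finally show ?thesis .
  qed
  define \<kappa> where "\<kappa> = (1 - m) / l"
  have "(1 - m) * 1 < (1 - m) * l" using l m_less_1 by (intro mult_strict_left_mono) auto
  then have \<kappa>: "0 < \<kappa>" "\<kappa> < 1 - m" using l m_less_1 by (simp_all add: \<kappa>_def pos_divide_less_eq)
  define \<theta> where "\<theta> = 1 - \<kappa>"
  have \<theta>: "\<theta> > m" using \<kappa> by (simp add: \<theta>_def)
  \<comment> \<open>A level between \<open>m\<close> and 1, so that the sum \<open>n\<close> exceeds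
    this multiple of \<open>n + 1\<close> for large \<open>n\<close>. The exponent \<beta> puts the
    jump-free event below the jump rate, which is of order n^(1 - \<beta>).\<close>
  have "(1 + m) / 2 > m" using m_less_1 by simp
  from truncated_upper_tail[OF this, of \<beta>] obtain \<epsilon> where \<epsilon>: "\<epsilon> > 0"
    and ev: "\<forall>\<^sub>F n in sequentially. measure_pmf.prob (replicate_pmf n p)
      {xs. (1 + m) / 2 * real n \<le> real (sum_list xs) \<and> (\<forall>x\<in>set xs. real x \<le> \<epsilon> * real n)} \<le> real n powr (- \<beta>)"
    by blast
  obtain k0 where k0: "\<And>k. k \<ge> k0 \<Longrightarrow> pmf p k \<le> l * (c * real k powr (- \<beta>))"
    using pmf_le[OF l] by (auto simp: eventually_at_top_linorder)
  define P where "P n = measure_pmf.prob (replicate_pmf n p) {xs. \<theta> * real n \<le> real (sum_list xs)}" for n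
  \<comment> \<open>The jump-free part and the atypical remainders, relative to the jump
    rate.\<close>
  define err where "err n = (1 - m) powr \<beta> / (c * real (Suc n)) + l * ((1 - m) / \<epsilon>) powr \<beta> * P n" for n
  have "(\<lambda>n. 1 / (c * real (Suc n))) \<longlonglongrightarrow> 0" using c_pos by real_asymp
  then have "(\<lambda>n. (1 - m) powr \<beta> * (1 / (c * real (Suc n))) + l * ((1 - m) / \<epsilon>) powr \<beta> * P n) \<longlonglongrightarrow>
    (1 - m) powr \<beta> * 0 + l * ((1 - m) / \<epsilon>) powr \<beta> * 0"
    unfolding P_def by (intro tendsto_intros wlln_upper \<theta>)
  then have "err \<longlonglongrightarrow> 0" unfolding err_def by simp
  then have err: "\<forall>\<^sub>F n in sequentially. err n < e / 2" using e by (intro order_tendstoD(2)) auto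
  have "\<forall>\<^sub>F n in sequentially. (1 + m) / 2 * real (Suc n) \<le> real n"
    using m_less_1 by real_asymp
  moreover have "\<forall>\<^sub>F n in sequentially. real k0 \<le> \<epsilon> * real n"
    using \<epsilon> by real_asymp
  moreover have "\<forall>\<^sub>F n in sequentially. measure_pmf.prob (replicate_pmf (Suc n) p)
      {xs. (1 + m) / 2 * real (Suc n) \<le> real (sum_list xs) \<and> (\<forall>x\<in>set xs. real x \<le> \<epsilon> * real (Suc n))} \<le> real (Suc n) powr (- \<beta>)"
    using ev by (subst eventually_sequentially_Suc)
  ultimately show ?thesis using err eventually_gt_at_top[of 0]
  proof eventually_elim
    case (elim n)
    define u where "u = c * ((1 - m) * real n) powr (- \<beta>)"
    have u: "u > 0" using c_pos m_less_1 elim by (simp add: u_def)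
    let ?b = "\<epsilon> * real (Suc n)"
    have "measure_pmf.prob (replicate_pmf (Suc n) p) {xs. sum_list xs = n \<and> (\<forall>x\<in>set xs. real x \<le> ?b)} \<le>
      measure_pmf.prob (replicate_pmf (Suc n) p)
      {xs. (1 + m) / 2 * real (Suc n) \<le> real (sum_list xs) \<and> (\<forall>x\<in>set xs. real x \<le> ?b)}"
      using elim(1) by (intro measure_pmf.finite_measure_mono) auto
    also have "\<dots> \<le> real (Suc n) powr (- \<beta>)" by (rule elim(3))
    also have "\<dots> \<le> real n powr (- \<beta>)" using elim \<beta> by (intro powr_mono2') auto
    also have "\<dots> = (1 - m) powr \<beta> / c * u"
    proof -
      have "c * real n powr (- \<beta>) = (1 - m) powr \<beta> * u"
        using powr_scaled[OF zero_less_one, of n] by (simp only: u_def mult_1 div_by_1)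
      then have "real n powr (- \<beta>) = (1 - m) powr \<beta> * u / c"
        using c_pos by (metis nonzero_mult_div_cancel_left less_irrefl)
      then show ?thesis by simp
    qed
    finally have no_jump: "measure_pmf.prob (replicate_pmf (Suc n) p) {xs. sum_list xs = n \<and> (\<forall>x\<in>set xs. real x \<le> ?b)}
      \<le> (1 - m) powr \<beta> / c * u" .
    let ?G = "\<lambda>ys. if sum_list ys \<le> n \<and> ?b < real (n - sum_list ys) then pmf p (n - sum_list ys) else 0"
    define T1 where "T1 = l * l powr \<beta> * u"
    define T2 where "T2 = l * ((1 - m) / \<epsilon>) powr \<beta> * u"
    have T: "0 \<le> T1" "0 \<le> T2" using l u by (simp_all add: T1_def T2_def)
    let ?I = "indicator {xs. \<theta> * real n \<le> real (sum_list xs)} :: nat list \<Rightarrow> real"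
    \<comment> \<open>For large remainders only the truncation level bounds the jump from below,
      which gives \<open>T2\<close>; otherwise the jump is at least \<open>\<kappa> n\<close>, which
      gives \<open>T1\<close>.\<close>
    have ptwise: "?G ys \<le> T1 + T2 * ?I ys" for ys
    proof (cases "sum_list ys \<le> n \<and> ?b < real (n - sum_list ys)")
      case True
      define k where "k = n - sum_list ys"
      have G: "?G ys = pmf p k" unfolding k_def by (rule if_P[OF True])
      have "\<epsilon> * real n \<le> ?b" using \<epsilon> by (intro mult_left_mono) auto
      moreover have "?b < real k" using True unfolding k_def by blast
      ultimately have k: "\<epsilon> * real n < real k" by (rule le_less_trans)
      have pos: "0 < \<epsilon> * real n" using \<epsilon> elim by simp
      have "k \<ge> k0" using k elim(2) by simp
      then have pk: "pmf p k \<le> l * (c * real k powr (- \<beta>))" by (rule k0)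
      have "pmf p k \<le> T1 + T2 * ?I ys"
      proof (cases "\<theta> * real n \<le> real (sum_list ys)")
        case big: True
        have "real k powr (- \<beta>) \<le> (\<epsilon> * real n) powr (- \<beta>)"
          using k pos \<beta> by (intro powr_mono2') auto
        then have "l * (c * real k powr (- \<beta>)) \<le> l * (c * (\<epsilon> * real n) powr (- \<beta>))"
          using l c_pos by (intro mult_left_mono) auto
        also have "\<dots> = T2"
          unfolding powr_scaled[OF \<epsilon>] u_def T2_def by (simp only: mult.assoc)
        finally have "pmf p k \<le> T2" by (rule order_trans[OF pk])
        moreover have "?I ys = 1" using big by (simp only: indicator_simps mem_Collect_eq)
        ultimately show ?thesis using T by simp
      next
        case small: False
        have "real k = real n - real (sum_list ys)" using True unfolding k_def by (intro of_nat_diff) blast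
        then have "\<kappa> * real n \<le> real k" using small unfolding \<theta>_def left_diff_distrib by linarith
        then have "real k powr (- \<beta>) \<le> (\<kappa> * real n) powr (- \<beta>)"
          using \<kappa> \<beta> elim by (intro powr_mono2') auto
        then have "l * (c * real k powr (- \<beta>)) \<le> l * (c * (\<kappa> * real n) powr (- \<beta>))"
          using l c_pos by (intro mult_left_mono) auto
        also have "\<dots> = T1"
        proof -
          have "(1 - m) / \<kappa> = l" using m_less_1 by (simp add: \<kappa>_def)
          then show ?thesis unfolding powr_scaled[OF \<kappa>(1)] u_def T1_def by (simp only: mult.assoc)
        qed
        finally have "pmf p k \<le> T1" by (rule order_trans[OF pk])
        moreover have "?I ys = 0" using small by (simp only: indicator_simps mem_Collect_eq not_False_eq_True)
        ultimately show ?thesis by simp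
      qed
      then show ?thesis unfolding G .
    next
      case False
      then have "?G ys = 0" by (rule if_not_P)
      moreover have "0 \<le> T1 + T2 * ?I ys" using T by simp
      ultimately show ?thesis by (simp only:)
    qed
    have intI: "integrable (walk n) ?I"
      by (intro measure_pmf.integrable_const_bound[where B=1]) auto
    have "measure_pmf.expectation (replicate_pmf n p) ?G \<le> measure_pmf.expectation (replicate_pmf n p) (\<lambda>ys. T1 + T2 * ?I ys)"
    proof (rule integral_mono[OF _ _ ptwise])
      show "integrable (walk n) ?G"
      proof (rule measure_pmf.integrable_const_bound[where B=1])
        show "AE ys in walk n. norm (?G ys) \<le> 1" by (rule AE_I2) (simp add: pmf_le_1 del: of_nat_Suc)
      qed simp
    qed (use intI in simp)
    also have "\<dots> = T1 + T2 * P n"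
      using intI by (simp add: P_def)
    also have "\<dots> = (l * l powr \<beta> + l * ((1 - m) / \<epsilon>) powr \<beta> * P n) * u"
      unfolding T1_def T2_def distrib_right by (simp only: mult_ac)
    finally have jump: "measure_pmf.expectation (replicate_pmf n p) ?G \<le> (l * l powr \<beta> + l * ((1 - m) / \<epsilon>) powr \<beta> * P n) * u" .
    have "measure_pmf.prob (replicate_pmf (Suc n) p) {xs. sum_list xs = n} \<le>
      (1 - m) powr \<beta> / c * u + real (Suc n) * ((l * l powr \<beta> + l * ((1 - m) / \<epsilon>) powr \<beta> * P n) * u)"
      by (rule order_trans[OF prob_le_no_jump_plus_jump[of n ?b]
            add_mono[OF no_jump mult_left_mono[OF jump of_nat_0_le_iff]]])
    also have "\<dots> = real (Suc n) * u * (l * l powr \<beta> + err n)"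
    proof -
      have "a / c * v + N * ((x + y) * v) = N * v * (x + (a / (c * N) + y))" if "N \<noteq> 0" for a v x y N :: real
        using that c_pos by (simp add: field_simps)
      from this[OF of_nat_neq_0] show ?thesis unfolding err_def .
    qed
    also have "\<dots> \<le> real (Suc n) * u * (1 + e)"
    proof (rule mult_left_mono)
      show "l * l powr \<beta> + err n \<le> 1 + e" unfolding l_powr using elim(4) by linarith
      show "0 \<le> real (Suc n) * u" using u by simp
    qed
    finally show ?case unfolding jump_rate_def u_def by (simp only: mult_ac)
  qed
qed

text \<open>Keeping all other entries at or below \<open>b\<close> makes the possible positions of
  the jump mutually exclusive, so summing over them counts no list twice. Since \<open>f\<close>
  does not see an entry above \<open>b\<close>, it can be evaluated as \<open>f'\<close> on the
  remainder.\<close>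

lemma one_jump_le:
  fixes f f' :: "nat list \<Rightarrow> real"
  assumes f: "\<And>xs. 0 \<le> f xs" "\<And>xs. f xs \<le> 1" and f': "\<And>xs. 0 \<le> f' xs" "\<And>xs. f' xs \<le> 1"
    and ff': "\<And>xs i. i < length xs \<Longrightarrow> b < real (xs ! i) \<Longrightarrow> f xs = f' (remove_nth i xs)"
  shows "real (Suc n) * measure_pmf.expectation (replicate_pmf n p)
      (\<lambda>ys. if (\<forall>y\<in>set ys. real y \<le> b) \<and> sum_list ys \<le> n \<and> b < real (n - sum_list ys)
         then f' ys * pmf p (n - sum_list ys) else 0) \<le>
    measure_pmf.expectation (replicate_pmf (Suc n) p) (\<lambda>xs. f xs * indicator {xs. sum_list xs = n} xs)"
  (is "_ * measure_pmf.expectation _ ?G \<le> measure_pmf.expectation _ ?F")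
proof -
  define H :: "nat \<Rightarrow> nat list \<Rightarrow> ennreal" where
    "H x ys = (if (\<forall>y\<in>set ys. real y \<le> b) \<and> b < real x \<and> x + sum_list ys = n then ennreal (f' ys) else 0)" for x ys
  have G: "(\<integral>\<^sup>+x. H x ys \<partial>p) = ennreal (?G ys)" for ys
  proof -
    have "(\<integral>\<^sup>+x. H x ys \<partial>p) = (\<integral>\<^sup>+x. (if (\<forall>y\<in>set ys. real y \<le> b) \<and> sum_list ys \<le> n \<and> b < real (n - sum_list ys) then ennreal (f' ys) else 0) * indicator {n - sum_list ys} x \<partial>p)"
      by (intro nn_integral_cong) (auto simp: H_def indicator_def)
    then show ?thesis using f' by (auto simp: nn_integral_cmult emeasure_pmf_single ennreal_mult)
  qed
  have intG: "integrable (walk n) ?G"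
    using f' by (intro measure_pmf.integrable_const_bound[where B=1]) (auto simp: pmf_le_1 mult_le_one abs_mult)
  have intF: "integrable (walk (Suc n)) ?F"
    using f by (intro measure_pmf.integrable_const_bound[where B=1]) (auto simp: indicator_def)
  have "of_nat (Suc n) * ennreal (measure_pmf.expectation (replicate_pmf n p) ?G) = of_nat (Suc n) * (\<integral>\<^sup>+ys. ennreal (?G ys) \<partial>walk n)"
    using intG f' by (subst nn_integral_eq_integral) auto
  also have "(\<integral>\<^sup>+ys. ennreal (?G ys) \<partial>walk n) = (\<integral>\<^sup>+x. \<integral>\<^sup>+ys. H x ys \<partial>walk n \<partial>p)"
    unfolding G[symmetric] by (rule nn_integral_pmf_swap)
  also have "of_nat (Suc n) * \<dots> = (\<integral>\<^sup>+xs. (\<Sum>i\<le>n. H (xs ! i) (remove_nth i xs)) \<partial>walk (Suc n))"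
    by (rule nn_integral_replicate_pmf_sum_nth[symmetric])
  also have "\<dots> \<le> (\<integral>\<^sup>+xs. ennreal (?F xs) \<partial>walk (Suc n))"
  proof (intro nn_integral_mono_AE, simp only: AE_measure_pmf_iff, intro ballI)
    fix xs assume "xs \<in> set_pmf (replicate_pmf (Suc n) p)"
    then have len: "length xs = Suc n" by (rule length_replicate_pmf)
    show "(\<Sum>i\<le>n. H (xs ! i) (remove_nth i xs)) \<le> ennreal (?F xs)"
    proof (cases "\<exists>i\<le>n. H (xs ! i) (remove_nth i xs) \<noteq> 0")
      case True
      then obtain i where i: "i \<le> n" "H (xs ! i) (remove_nth i xs) \<noteq> 0" by blast
      then have i': "b < real (xs ! i)" "xs ! i + sum_list (remove_nth i xs) = n"
        by (auto simp: H_def split: if_splits)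
      \<comment> \<open>Removing another entry leaves the large one in the list, which violates the
        bound built into \<open>H\<close>.\<close>
      have "H (xs ! j) (remove_nth j xs) = 0" if "j \<le> n" "j \<noteq> i" for j
      proof -
        have "xs ! i \<in> set (remove_nth j xs)" using that i len by (intro nth_in_set_remove_nth) auto
        then show ?thesis using i'(1) by (auto simp: H_def)
      qed
      then have "(\<Sum>i\<le>n. H (xs ! i) (remove_nth i xs)) = (\<Sum>j\<in>{i}. H (xs ! j) (remove_nth j xs))"
        using i by (intro sum.mono_neutral_right) auto
      also have "\<dots> \<le> ennreal (f' (remove_nth i xs))" by (simp add: H_def)
      also have "\<dots> = ennreal (?F xs)"
        using i' i len ff'[of i xs] sum_list_remove_nth[of i xs] by simp
      finally show ?thesis .
    next
      case False
      then show ?thesis by simp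
    qed
  qed
  also have "\<dots> = ennreal (measure_pmf.expectation (replicate_pmf (Suc n) p) ?F)"
    using intF f by (intro nn_integral_eq_integral) auto
  finally have "ennreal (real (Suc n) * measure_pmf.expectation (replicate_pmf n p) ?G) \<le>
    ennreal (measure_pmf.expectation (replicate_pmf (Suc n) p) ?F)"
    using f' by (simp add: ennreal_of_nat_eq_real_of_nat ennreal_mult integral_nonneg_AE del: replicate_pmf.simps of_nat_Suc)
  then show ?thesis using f by (subst (asm) ennreal_le_iff) (auto intro!: integral_nonneg_AE)
qed

text \<open>On typical remainders the forced jump is at most \<open>l * (1 - m) * n\<close>, which
  bounds its atom from below. The quantifiers over \<open>f\<close> and \<open>f'\<close> stand
  inside the eventuality because both will vary with \<open>n\<close>.\<close>

lemma local_lower_bound: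
  assumes e: "0 < e" "e < 1"
  shows "\<forall>\<^sub>F n in sequentially. \<forall>f f' :: nat list \<Rightarrow> real.
    (\<forall>xs. 0 \<le> f xs \<and> f xs \<le> 1) \<longrightarrow> (\<forall>ys. 0 \<le> f' ys \<and> f' ys \<le> 1) \<longrightarrow>
    (\<forall>xs i. i < length xs \<longrightarrow> K < real (xs ! i) \<longrightarrow> f xs = f' (remove_nth i xs)) \<longrightarrow>
    (1 - e) * jump_rate n * (measure_pmf.expectation (replicate_pmf n p) f' - e) \<le>
    measure_pmf.expectation (replicate_pmf (Suc n) p) (\<lambda>xs. f xs * indicator {xs. sum_list xs = n} xs)"
proof -
  \<comment> \<open>Here \<open>l powr (\<beta> + 1) = 1 / (1 - e)\<close>, shared as before between
    the atoms and the size of the jump.\<close>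
  define l where "l = (1 / (1 - e)) powr (1 / (\<beta> + 1))"
  have l: "l > 1" using e \<beta> unfolding l_def by (intro gr_one_powr) auto
  have l_powr: "1 / l * (1 / l) powr \<beta> = 1 - e"
  proof -
    have "1 / l * (1 / l) powr \<beta> = 1 / (l powr (\<beta> + 1))" using l by (simp add: powr_add powr_divide)
    also have "\<dots> = 1 - e" using e \<beta> by (simp add: l_def powr_powr)
    finally show ?thesis .
  qed
  \<comment> \<open>A remainder above \<open>\<theta>1 * n\<close> forces a jump of at most
    \<open>l * (1 - m) * n\<close>. One below \<open>\<theta>2 * n\<close> forces a jump above
    \<open>(1 - m) / 2 * n\<close>, twice the bound \<open>\<delta> * n\<close> imposed on the other
    entries.\<close>
  define \<theta>1 where "\<theta>1 = 1 - l * (1 - m)"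
  define \<theta>2 where "\<theta>2 = (1 + m) / 2"
  define \<delta> where "\<delta> = (1 - m) / 4"
  have "1 * (1 - m) < l * (1 - m)" using l m_less_1 by (intro mult_strict_right_mono) auto
  then have \<theta>1: "\<theta>1 < measure_pmf.expectation p real" by (simp add: \<theta>1_def mean)
  have \<theta>2: "\<theta>2 > m" using m_less_1 by (simp add: \<theta>2_def)
  have \<delta>: "\<delta> > 0" using m_less_1 by (simp add: \<delta>_def)
  obtain k0 where k0: "\<And>k. k \<ge> k0 \<Longrightarrow> pmf p k \<ge> 1 / l * (c * real k powr (- \<beta>))"
    using pmf_ge[of "1 / l"] l by (auto simp: eventually_at_top_linorder)
  define B1 where "B1 n = {xs :: nat list. \<exists>x\<in>set xs. real x > \<delta> * real n}" for n
  define B2 where "B2 n = {xs :: nat list. real (sum_list xs) \<le> \<theta>1 * real n}" for n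
  define B3 where "B3 n = {xs :: nat list. \<theta>2 * real n \<le> real (sum_list xs)}" for n
  define bad where "bad n = B1 n \<union> B2 n \<union> B3 n" for n
  have "(\<lambda>n. measure_pmf.prob (replicate_pmf n p) (B1 n) + measure_pmf.prob (replicate_pmf n p) (B2 n) +
      measure_pmf.prob (replicate_pmf n p) (B3 n)) \<longlonglongrightarrow> 0 + 0 + 0"
    unfolding B1_def B2_def B3_def
    by (intro tendsto_add max_tendsto_0 \<delta> wlln_lower integrable_id \<theta>1 wlln_upper \<theta>2)
  then have "\<forall>\<^sub>F n in sequentially. measure_pmf.prob (replicate_pmf n p) (B1 n) + measure_pmf.prob (replicate_pmf n p) (B2 n) +
      measure_pmf.prob (replicate_pmf n p) (B3 n) < e"
    using e by (intro order_tendstoD(2)) auto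
  moreover have "\<forall>\<^sub>F n in sequentially. real k0 \<le> \<delta> * real n" using \<delta> by real_asymp
  moreover have "\<forall>\<^sub>F n in sequentially. K \<le> \<delta> * real n" using \<delta> by real_asymp
  ultimately show ?thesis using eventually_gt_at_top[of 0]
  proof eventually_elim
    case (elim n)
    define u where "u = c * ((1 - m) * real n) powr (- \<beta>)"
    have u: "u > 0" using c_pos m_less_1 elim by (simp add: u_def)
    have bad: "measure_pmf.prob (replicate_pmf n p) (bad n) < e"
    proof -
      have "measure_pmf.prob (replicate_pmf n p) (bad n) \<le>
        measure_pmf.prob (replicate_pmf n p) (B1 n) + measure_pmf.prob (replicate_pmf n p) (B2 n) + measure_pmf.prob (replicate_pmf n p) (B3 n)"
        unfolding bad_def by (intro order_trans[OF measure_Un_le] add_mono) auto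
      then show ?thesis using elim(1) by linarith
    qed
    show ?case
    proof (intro allI impI)
      fix f f' :: "nat list \<Rightarrow> real"
      assume f: "\<forall>xs. 0 \<le> f xs \<and> f xs \<le> 1" and f': "\<forall>ys. 0 \<le> f' ys \<and> f' ys \<le> 1"
        and ff': "\<forall>xs i. i < length xs \<longrightarrow> K < real (xs ! i) \<longrightarrow> f xs = f' (remove_nth i xs)"
      let ?b = "\<delta> * real n"
      let ?G = "\<lambda>ys. if (\<forall>y\<in>set ys. real y \<le> ?b) \<and> sum_list ys \<le> n \<and> ?b < real (n - sum_list ys)
         then f' ys * pmf p (n - sum_list ys) else 0"
      \<comment> \<open>On bad lists the left-hand side is at most 0 because \<open>f'\<close> is at
        most 1, so the exception costs no more than the probability of \<open>bad\<close>.\<close>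
      have ptwise: "(1 - e) * u * (f' ys - indicator (bad n) ys) \<le> ?G ys" for ys
      proof (cases "ys \<in> bad n")
        case True
        have "f' ys \<le> 1" using f' by simp
        then have "(1 - e) * u * (f' ys - indicator (bad n) ys) \<le> 0"
          using True e u by (intro mult_nonneg_nonpos) auto
        also have "0 \<le> ?G ys" using f' by auto
        finally show ?thesis .
      next
        case False
        then have ys: "\<forall>y\<in>set ys. real y \<le> ?b" "\<theta>1 * real n < real (sum_list ys)" "real (sum_list ys) < \<theta>2 * real n"
          by (auto simp: bad_def B1_def B2_def B3_def not_less not_le)
        have "\<theta>2 * real n \<le> 1 * real n" using m_less_1 by (intro mult_right_mono) (auto simp: \<theta>2_def)
        then have le: "sum_list ys \<le> n" using ys(3) by simp
        define k where "k = n - sum_list ys"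
        have k: "real k = real n - real (sum_list ys)" using le by (simp add: k_def of_nat_diff)
        have "(1 - \<theta>2) * real n < real k" using ys(3) k by (simp add: algebra_simps)
        moreover have "?b \<le> (1 - \<theta>2) * real n" using m_less_1 by (intro mult_right_mono) (auto simp: \<delta>_def \<theta>2_def field_simps)
        ultimately have kb: "?b < real k" by linarith
        have kl: "real k \<le> (l * (1 - m)) * real n" using ys(2) k by (simp add: \<theta>1_def algebra_simps)
        have "k \<ge> k0" using kb elim(2) by simp
        then have pk: "1 / l * (c * real k powr (- \<beta>)) \<le> pmf p k" by (rule k0)
        have "0 < real k" using kb \<delta> by (meson less_le_trans mult_nonneg_nonneg of_nat_0_le_iff less_imp_le le_less_trans)
        then have "((l * (1 - m)) * real n) powr (- \<beta>) \<le> real k powr (- \<beta>)"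
          using kl \<beta> by (intro powr_mono2') auto
        then have "1 / l * (c * ((l * (1 - m)) * real n) powr (- \<beta>)) \<le> 1 / l * (c * real k powr (- \<beta>))"
          using l c_pos by (intro mult_left_mono) auto
        moreover have "1 / l * (c * ((l * (1 - m)) * real n) powr (- \<beta>)) = (1 - e) * u"
          using powr_scaled[of "l * (1 - m)" n] l m_less_1 by (simp add: u_def l_powr[symmetric])
        ultimately have "(1 - e) * u \<le> pmf p k" using pk by linarith
        then have "(1 - e) * u * f' ys \<le> f' ys * pmf p k" using f' by (simp add: mult.commute mult_left_mono)
        then show ?thesis using False ys(1) le kb by (simp add: k_def)
      qed
      have intf': "integrable (walk n) f'"
        using f' by (intro measure_pmf.integrable_const_bound[where B=1]) auto
      have intG: "integrable (walk n) ?G"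
        using f' by (intro measure_pmf.integrable_const_bound[where B=1]) (auto simp: pmf_le_1 mult_le_one abs_mult)
      have intb: "integrable (walk n) (indicat_real (bad n))"
        by (intro measure_pmf.integrable_const_bound[where B=1]) auto
      have "(1 - e) * jump_rate n * (measure_pmf.expectation (replicate_pmf n p) f' - e) \<le>
        (1 - e) * jump_rate n * (measure_pmf.expectation (replicate_pmf n p) f' - measure_pmf.prob (replicate_pmf n p) (bad n))"
        using bad e jump_rate_pos[OF elim(4)] by (intro mult_left_mono) auto
      also have "\<dots> = real (Suc n) * ((1 - e) * u * (measure_pmf.expectation (replicate_pmf n p) f' - measure_pmf.prob (replicate_pmf n p) (bad n)))"
        by (simp add: jump_rate_def u_def)
      also have "(1 - e) * u * (measure_pmf.expectation (replicate_pmf n p) f' - measure_pmf.prob (replicate_pmf n p) (bad n)) =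
        measure_pmf.expectation (replicate_pmf n p) (\<lambda>ys. (1 - e) * u * (f' ys - indicator (bad n) ys))"
        using intf' intb by simp
      also have "real (Suc n) * \<dots> \<le> real (Suc n) * measure_pmf.expectation (replicate_pmf n p) ?G"
        using intf' intb intG by (intro mult_left_mono integral_mono ptwise) auto
      also have "\<dots> \<le> measure_pmf.expectation (replicate_pmf (Suc n) p) (\<lambda>xs. f xs * indicator {xs. sum_list xs = n} xs)"
      proof (rule one_jump_le)
        fix xs i assume "i < length xs" "?b < real (xs ! i)"
        then show "f xs = f' (remove_nth i xs)" using ff' elim(3) by auto
      qed (use f f' in auto)
      finally show "(1 - e) * jump_rate n * (measure_pmf.expectation (replicate_pmf n p) f' - e) \<le>
        measure_pmf.expectation (replicate_pmf (Suc n) p) (\<lambda>xs. f xs * indicator {xs. sum_list xs = n} xs)" .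
    qed
  qed
qed

text \<open>The lower bound for the constant function 1, with \<open>e = 1/2\<close>; it makes the
  conditioning meaningful for all large \<open>n\<close>.\<close>

lemma prob_sum_list_pos: "\<forall>\<^sub>F n in sequentially. measure_pmf.prob (replicate_pmf (Suc n) p) {xs. sum_list xs = n} > 0"
proof -
  have "\<forall>\<^sub>F n in sequentially. (1 - 1/2) * jump_rate n * (1 - 1/2) \<le> measure_pmf.prob (replicate_pmf (Suc n) p) {xs. sum_list xs = n}"
    using local_lower_bound[of "1/2" 0]
    by (rule eventually_mono) (auto dest!: spec[of _ "\<lambda>_. 1"] simp del: replicate_pmf.simps)
  then show ?thesis using eventually_gt_at_top[of 0]
  proof eventually_elim
    case (elim n)
    have "0 < (1 - 1/2) * jump_rate n * (1 - 1/2)" using jump_rate_pos[OF elim(2)] by simp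
    then show ?case using elim(1) by (rule less_le_trans)
  qed
qed

text \<open>The lower bound for \<open>f\<close> and for \<open>1 - f\<close>, together with the matching upper bound
  for the total mass, pins down the conditional expectation.\<close>
lemma conditional_expectation_tendsto:
  fixes f f' :: "nat \<Rightarrow> nat list \<Rightarrow> real"
  assumes f: "\<And>n xs. 0 \<le> f n xs" "\<And>n xs. f n xs \<le> 1" and f': "\<And>n xs. 0 \<le> f' n xs" "\<And>n xs. f' n xs \<le> 1"
    and ff': "\<And>n xs i. i < length xs \<Longrightarrow> K < real (xs ! i) \<Longrightarrow> f n xs = f' n (remove_nth i xs)"
    and lim: "(\<lambda>n. measure_pmf.expectation (replicate_pmf n p) (f' n)) \<longlonglongrightarrow> L"
  shows "(\<lambda>n. measure_pmf.expectation (replicate_pmf (Suc n) p) (\<lambda>xs. f n xs * indicator {xs. sum_list xs = n} xs) /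
      measure_pmf.prob (replicate_pmf (Suc n) p) {xs. sum_list xs = n}) \<longlonglongrightarrow> L"
proof -
  define E where "E n = measure_pmf.expectation (replicate_pmf n p) (f' n)" for n
  define U where "U n = measure_pmf.expectation (replicate_pmf (Suc n) p) (\<lambda>xs. f n xs * indicator {xs. sum_list xs = n} xs)" for n
  define P where "P n = measure_pmf.prob (replicate_pmf (Suc n) p) {xs. sum_list xs = n}" for n
  have intf': "integrable (walk n) (f' n)" for n
    using f' by (intro measure_pmf.integrable_const_bound[where B=1]) auto
  have E: "0 \<le> E n" "E n \<le> 1" for n
    using f' unfolding E_def by (auto intro!: integral_nonneg_AE measure_pmf.integral_le_const intf')
  have intf: "integrable (walk (Suc n)) (\<lambda>xs. f n xs * indicator {xs. sum_list xs = n} xs)" for n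
    using f by (intro measure_pmf.integrable_const_bound[where B=1]) (auto simp: indicator_def)
  have compl: "measure_pmf.expectation (replicate_pmf (Suc n) p) (\<lambda>xs. (1 - f n xs) * indicator {xs. sum_list xs = n} xs) = P n - U n" for n
  proof -
    have "integrable (walk (Suc n)) (indicat_real {xs. sum_list xs = n})"
      by (intro measure_pmf.integrable_const_bound[where B=1]) auto
    then show ?thesis using intf[of n]
      by (simp add: left_diff_distrib P_def U_def del: replicate_pmf.simps)
  qed
  have U: "0 \<le> U n" "U n \<le> P n" for n
  proof -
    show "0 \<le> U n" using f unfolding U_def by (auto intro!: integral_nonneg_AE)
    have "0 \<le> P n - U n" using f unfolding compl[symmetric] by (auto intro!: integral_nonneg_AE)
    then show "U n \<le> P n" by simp
  qed
  have "(\<lambda>n. U n / P n - E n) \<longlonglongrightarrow> 0"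
  proof (rule tendstoI)
    fix e' :: real assume e': "e' > 0"
    define e where "e = min (1/2) (e' / 4)"
    have e: "0 < e" "e < 1" "3 * e < e'" using e' by (auto simp: e_def min_def)
    \<comment> \<open>Turns a lower bound in units of the rate into one in units of
      \<open>P n\<close>. It serves for \<open>f\<close> with \<open>x = E n\<close> and for
      \<open>1 - f\<close> with \<open>x = 1 - E n\<close>.\<close>
    have arith: "(x - 3 * e) * P n \<le> u"
      if a: "0 < a" and ub: "P n \<le> (1 + e) * a" and "0 < P n" "0 \<le> u" "x \<le> 1" "(1 - e) * a * (x - e) \<le> u" for x u a n
    proof (cases "x \<le> 3 * e")
      case True
      then have "(x - 3 * e) * P n \<le> 0" using that by (intro mult_nonpos_nonneg) auto
      then show ?thesis using that by linarith
    next
      case False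
      then have "(x - 3 * e) * P n \<le> (x - 3 * e) * ((1 + e) * a)" using ub by (intro mult_left_mono) auto
      also have "\<dots> = (1 - e) * a * (x - e) - 2 * e * a * (1 - x) - 4 * e * e * a" by (simp add: algebra_simps)
      also have "\<dots> \<le> (1 - e) * a * (x - e)"
      proof -
        have "0 \<le> 2 * e * a * (1 - x)" "0 \<le> 4 * e * e * a" using e a that(5) by auto
        then show ?thesis by linarith
      qed
      finally show ?thesis using that by linarith
    qed
    show "\<forall>\<^sub>F n in sequentially. dist (U n / P n - E n) 0 < e'"
      using local_lower_bound[OF e(1,2), of K] local_upper_bound[OF e(1)] prob_sum_list_pos eventually_gt_at_top[of 0]
    proof eventually_elim
      case (elim n)
      note lower = elim(1)[rule_format]
      have P: "0 < P n" "P n \<le> (1 + e) * jump_rate n" using elim by (auto simp: P_def)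
      have "(1 - e) * jump_rate n * (E n - e) \<le> U n"
        unfolding E_def U_def by (rule lower) (use f f' ff' in auto)
      from arith[OF jump_rate_pos[OF elim(4)] P(2,1) U(1) E(2) this]
      have 1: "E n - 3 * e \<le> U n / P n" using P by (simp add: pos_le_divide_eq)
      have "(1 - e) * jump_rate n * (measure_pmf.expectation (replicate_pmf n p) (\<lambda>ys. 1 - f' n ys) - e) \<le> P n - U n"
        unfolding compl[symmetric] by (rule lower) (use f f' ff' in auto)
      also have "measure_pmf.expectation (replicate_pmf n p) (\<lambda>ys. 1 - f' n ys) = 1 - E n"
        using intf' by (simp add: E_def)
      finally have "(1 - e) * jump_rate n * (1 - E n - e) \<le> P n - U n" .
      from arith[OF jump_rate_pos[OF elim(4)] P(2,1) _ _ this] U[of n] E[of n]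
      have "(1 - E n - 3 * e) * P n \<le> P n - U n" by simp
      then have "U n \<le> (E n + 3 * e) * P n" by (simp add: algebra_simps)
      then have 2: "U n / P n \<le> E n + 3 * e" using P by (simp add: pos_divide_le_eq)
      show ?case using 1 2 e by (simp add: dist_real_def abs_le_iff)
    qed
  qed
  from tendsto_add[OF this lim] show ?thesis by (simp add: U_def P_def E_def)
qed

end

section \<open>Outdegrees in trees and forests\<close>

text \<open>The weight and the outdegree counts of a tree depend on this multiset alone, so the
  order of the vertices need not be tracked.\<close>

fun outdegs :: "ptree \<Rightarrow> nat multiset" where
  "outdegs (Node ts) = add_mset (length ts) (sum_list (map outdegs ts))"

lemma prod_mset_sum_list: "prod_mset (sum_list Ms) = prod_list (map prod_mset Ms)"
  for Ms :: "'a::comm_monoid_mult multiset list"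
  by (induction Ms) auto

lemma image_mset_sum_list: "image_mset f (sum_list Ms) = sum_list (map (image_mset f) Ms)"
  by (induction Ms) auto

lemma filter_mset_sum_list: "filter_mset P (sum_list Ms) = sum_list (map (filter_mset P) Ms)"
  by (induction Ms) auto

lemma size_sum_list: "size (sum_list Ms) = sum_list (map size Ms)" for Ms :: "'a multiset list"
  by (induction Ms) auto

lemma gw_weight_outdegs: "gw_weight \<mu> T = prod_mset (image_mset \<mu> (outdegs T))"
proof (induction T)
  case (Node ts)
  then have "map (gw_weight \<mu>) ts = map (prod_mset \<circ> (image_mset \<mu> \<circ> outdegs)) ts" by simp
  then show ?case by (simp del: map_eq_conv add: image_mset_sum_list prod_mset_sum_list)
qed

lemma count_outdeg_outdegs: "count_outdeg A T = size (filter_mset (\<lambda>d. d \<in> A) (outdegs T))"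
proof (induction T)
  case (Node ts)
  then have "map (count_outdeg A) ts = map (size \<circ> (filter_mset (\<lambda>d. d \<in> A) \<circ> outdegs)) ts" by simp
  then show ?case by (simp del: map_eq_conv add: filter_mset_sum_list size_sum_list)
qed

definition forests :: "nat \<Rightarrow> nat \<Rightarrow> ptree list set" where
  "forests n k = {fs. length fs = k \<and> sum_list (map tsize fs) = n}"

lemma tsize_pos: "tsize T \<ge> 1"
  by (cases T) auto

lemma length_le_sum_tsize: "length fs \<le> sum_list (map tsize fs)"
proof (induction fs)
  case (Cons T fs)
  then show ?case using tsize_pos[of T] by simp
qed simp

lemma forests_0: "forests 0 k = (if k = 0 then {[]} else {})"
proof -
  have "fs = []" if "sum_list (map tsize fs) = 0" for fs
    using length_le_sum_tsize[of fs] that by simp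
  then show ?thesis unfolding forests_def by (cases "k = 0") force+
qed

lemma forests_Suc_0: "forests (Suc n) 0 = {}"
  by (auto simp: forests_def)

text \<open>The inverse deletes the root of the first tree: its \<open>j\<close> subtrees move to
  the front of the forest, which loses one vertex.\<close>

definition graft :: "nat \<times> ptree list \<Rightarrow> ptree list" where
  "graft = (\<lambda>(j, gs). Node (take j gs) # drop j gs)"

lemma bij_betw_graft:
  "bij_betw graft (SIGMA j:{..n}. forests n (j + k)) (forests (Suc n) (Suc k))"
proof (rule bij_betwI')
  fix x y assume "x \<in> (SIGMA j:{..n}. forests n (j + k))" "y \<in> (SIGMA j:{..n}. forests n (j + k))"
  then obtain j gs j' gs' where *: "x = (j, gs)" "y = (j', gs')" "length gs = j + k" "length gs' = j' + k"
    by (auto simp: forests_def)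
  show "graft x = graft y \<longleftrightarrow> x = y"
  proof
    assume "graft x = graft y"
    then have "take j gs = take j' gs'" "drop j gs = drop j' gs'" by (auto simp: graft_def *)
    moreover from this(1) have "length (take j gs) = length (take j' gs')" by simp
    then have "j = j'" using * by simp
    ultimately show "x = y" using * by (metis append_take_drop_id)
  qed simp
next
  fix x assume "x \<in> (SIGMA j:{..n}. forests n (j + k))"
  then obtain j gs where *: "x = (j, gs)" "length gs = j + k" "sum_list (map tsize gs) = n"
    by (auto simp: forests_def)
  have "sum_list (map tsize (take j gs @ drop j gs)) = n" using * by simp
  then have "sum_list (map tsize (take j gs)) + sum_list (map tsize (drop j gs)) = n"
    unfolding map_append sum_list_append .
  then show "graft x \<in> forests (Suc n) (Suc k)"
    using * by (simp add: graft_def forests_def)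
next
  fix fs assume "fs \<in> forests (Suc n) (Suc k)"
  then obtain ts hs where fs: "fs = Node ts # hs" "length hs = k"
    "sum_list (map tsize ts) + sum_list (map tsize hs) = n"
    by (auto simp: forests_def length_Suc_conv) (metis add_Suc add_Suc_right nat.inject plus_1_eq_Suc ptree.exhaust tsize.simps)
  \<comment> \<open>Each subtree carries at least one vertex, so the root degree is within the range
    \<open>{..n}\<close>.\<close>
  then have "(length ts, ts @ hs) \<in> (SIGMA j:{..n}. forests n (j + k))"
    using length_le_sum_tsize[of ts] by (auto simp: forests_def)
  moreover have "fs = graft (length ts, ts @ hs)" by (simp add: graft_def fs)
  ultimately show "\<exists>x\<in>(SIGMA j:{..n}. forests n (j + k)). fs = graft x" by blast
qed

lemma finite_forests: "finite (forests n k)"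
proof (induction n arbitrary: k)
  case 0
  then show ?case by (simp add: forests_0)
next
  case (Suc n)
  show ?case
  proof (cases k)
    case 0
    then show ?thesis by (simp add: forests_Suc_0)
  next
    case (Suc k')
    have "finite (SIGMA j:{..n}. forests n (j + k'))" using Suc.IH by auto
    then show ?thesis using bij_betw_finite[OF bij_betw_graft[of n k']] Suc by simp
  qed
qed

lemma sum_forests_Suc:
  "(\<Sum>fs\<in>forests (Suc n) (Suc k). h (sum_list (map outdegs fs))) =
   (\<Sum>j\<le>n. \<Sum>gs\<in>forests n (j + k). h (add_mset j (sum_list (map outdegs gs))))"
proof -
  have "(\<Sum>fs\<in>forests (Suc n) (Suc k). h (sum_list (map outdegs fs))) =
    (\<Sum>x\<in>(SIGMA j:{..n}. forests n (j + k)). h (sum_list (map outdegs (graft x))))"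
    by (rule sum.reindex_bij_betw[OF bij_betw_graft, symmetric])
  also have "\<dots> = (\<Sum>(j, gs)\<in>(SIGMA j:{..n}. forests n (j + k)). h (add_mset j (sum_list (map outdegs gs))))"
  proof (rule sum.cong[OF refl])
    fix x assume "x \<in> (SIGMA j:{..n}. forests n (j + k))"
    then obtain j gs where *: "x = (j, gs)" "length gs = j + k" by (auto simp: forests_def)
    have "sum_list (map outdegs (take j gs @ drop j gs)) = sum_list (map outdegs gs)" by simp
    then have "sum_list (map outdegs (take j gs)) + sum_list (map outdegs (drop j gs)) = sum_list (map outdegs gs)"
      unfolding map_append sum_list_append .
    then have "sum_list (map outdegs (graft x)) = add_mset j (sum_list (map outdegs gs))"
      using * by (simp add: graft_def)
    then show "h (sum_list (map outdegs (graft x))) =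
      (case x of (j, gs) \<Rightarrow> h (add_mset j (sum_list (map outdegs gs))))" by (simp add: *)
  qed
  also have "\<dots> = (\<Sum>j\<le>n. \<Sum>gs\<in>forests n (j + k). h (add_mset j (sum_list (map outdegs gs))))"
    by (subst sum.Sigma) (auto simp: finite_forests)
  finally show ?thesis .
qed

section \<open>Exchangeability of compositions and the Otter-Dwass formula\<close>

definition compositions :: "nat \<Rightarrow> nat \<Rightarrow> nat list set" where
  "compositions n s = {xs. length xs = n \<and> sum_list xs = s}"

lemma finite_compositions: "finite (compositions n s)"
proof (rule finite_subset)
  show "compositions n s \<subseteq> {xs. set xs \<subseteq> {..s} \<and> length xs = n}"
    using member_le_sum_list by (fastforce simp: compositions_def)
  show "finite {xs. set xs \<subseteq> {..s} \<and> length xs = n}" by (rule finite_lists_length_eq) simp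
qed

lemma sum_compositions_Suc:
  "(\<Sum>xs\<in>compositions (Suc n) s. f (hd xs) (tl xs)) = (\<Sum>j\<le>s. \<Sum>ys\<in>compositions n (s - j). f j ys)"
proof -
  have "bij_betw (\<lambda>(j, ys). j # ys) (SIGMA j:{..s}. compositions n (s - j)) (compositions (Suc n) s)"
    by (rule bij_betwI[where g="\<lambda>xs. (hd xs, tl xs)"]) (auto simp: compositions_def length_Suc_conv)
  from sum.reindex_bij_betw[OF this, of "\<lambda>xs. f (hd xs) (tl xs)"] show ?thesis
    by (subst sum.Sigma) (auto simp: finite_compositions split_def)
qed

text \<open>Swapping two positions permutes the compositions and preserves the multiset.\<close>

lemma sum_compositions_nth:
  fixes h :: "nat multiset \<Rightarrow> real"
  assumes "i < n"
  shows "(\<Sum>xs\<in>compositions n s. real (xs ! i) * h (mset xs)) = (\<Sum>xs\<in>compositions n s. real (xs ! 0) * h (mset xs))"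
proof -
  define sw where "sw xs = xs[0 := xs ! i, i := xs ! 0]" for xs :: "nat list"
  have len: "length (sw xs) = length xs" for xs by (simp add: sw_def)
  have ms: "mset (sw xs) = mset xs" if "length xs = n" for xs
    unfolding sw_def using that assms by (intro mset_swap) auto
  have inv: "sw (sw xs) = xs" if "length xs = n" for xs
    using that assms by (intro nth_equalityI) (auto simp: sw_def nth_list_update)
  have mem: "sw xs \<in> compositions n s" if "xs \<in> compositions n s" for xs
    using that ms[of xs] len[of xs] by (auto simp: compositions_def simp flip: sum_mset_sum_list)
  have "bij_betw sw (compositions n s) (compositions n s)"
    by (rule bij_betwI[where g=sw]) (use mem inv in \<open>auto simp: compositions_def\<close>)
  from sum.reindex_bij_betw[OF this, of "\<lambda>xs. real (xs ! i) * h (mset xs)", symmetric]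
  show ?thesis
    using assms by (auto intro!: sum.cong simp: compositions_def ms)
       (auto simp: sw_def nth_list_update)
qed

text \<open>All positions contribute equally, and the entries add up to \<open>s\<close>. This
  averaging supplies the factor that the cycle lemma would give.\<close>

lemma sum_compositions_hd:
  fixes h :: "nat multiset \<Rightarrow> real"
  shows "real (Suc n) * (\<Sum>xs\<in>compositions (Suc n) s. real (hd xs) * h (mset xs)) =
    real s * (\<Sum>xs\<in>compositions (Suc n) s. h (mset xs))"
proof -
  have "real s * (\<Sum>xs\<in>compositions (Suc n) s. h (mset xs)) =
    (\<Sum>xs\<in>compositions (Suc n) s. \<Sum>i<Suc n. real (xs ! i) * h (mset xs))"
    unfolding sum_distrib_left
  proof (rule sum.cong[OF refl])
    fix xs assume "xs \<in> compositions (Suc n) s"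
    then have "length xs = Suc n" "sum_list xs = s" by (auto simp: compositions_def)
    then have "real s = (\<Sum>i<Suc n. real (xs ! i))"
      unfolding of_nat_sum[symmetric] by (simp only: sum_list_sum_nth atLeast0LessThan)
    then show "real s * h (mset xs) = (\<Sum>i<Suc n. real (xs ! i) * h (mset xs))"
      by (simp only: sum_distrib_right)
  qed
  also have "\<dots> = (\<Sum>i<Suc n. \<Sum>xs\<in>compositions (Suc n) s. real (xs ! i) * h (mset xs))"
    by (rule sum.swap)
  also have "\<dots> = (\<Sum>i<Suc n. \<Sum>xs\<in>compositions (Suc n) s. real (xs ! 0) * h (mset xs))"
    by (intro sum.cong refl sum_compositions_nth) simp
  also have "\<dots> = real (Suc n) * (\<Sum>xs\<in>compositions (Suc n) s. real (xs ! 0) * h (mset xs))"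
    by simp
  also have "(\<Sum>xs\<in>compositions (Suc n) s. real (xs ! 0) * h (mset xs)) =
    (\<Sum>xs\<in>compositions (Suc n) s. real (hd xs) * h (mset xs))"
    by (intro sum.cong refl) (auto simp: compositions_def length_Suc_conv)
  finally show ?thesis by simp
qed

text \<open>The Otter--Dwass formula, by removing the first root instead of by the cycle lemma.\<close>
lemma otter_dwass:
  fixes h :: "nat multiset \<Rightarrow> real"
  assumes "k \<le> n"
  shows "real n * (\<Sum>fs\<in>forests n k. h (sum_list (map outdegs fs))) =
    real k * (\<Sum>xs\<in>compositions n (n - k). h (mset xs))"
  using assms
proof (induction n arbitrary: k h)
  case 0
  then show ?case by simp
next
  case (Suc n)
  show ?case
  proof (cases k)
    case 0
    then show ?thesis by (simp add: forests_Suc_0)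
  next
    case k: (Suc k')
    then have k': "k' \<le> n" using Suc.prems by simp
    define F where "F = (\<Sum>fs\<in>forests (Suc n) (Suc k'). h (sum_list (map outdegs fs)))"
    define H where "H = (\<Sum>xs\<in>compositions (Suc n) (n - k'). h (mset xs))"
    have F: "F = (\<Sum>j\<le>n. \<Sum>gs\<in>forests n (j + k'). h (add_mset j (sum_list (map outdegs gs))))"
      unfolding F_def by (rule sum_forests_Suc)
    have "real (Suc n) * F = real (Suc k') * H"
    \<comment> \<open>The recursion is multiplied by \<open>n\<close>, which is cancelled at the
      end.\<close>
    proof (cases "n = 0")
      case True
      have "compositions (Suc 0) 0 = {[0]}" by (auto simp: compositions_def length_Suc_conv)
      then show ?thesis using True k' F by (simp add: H_def forests_0)
    next
      case False
      \<comment> \<open>A forest has at least as many vertices as trees, so only root degrees up to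
        \<open>n - k'\<close> contribute; these are the possible first entries of a composition of
        \<open>n - k'\<close>.\<close>
      have empty: "forests n (j + k') = {}" if "j > n - k'" for j
      proof -
        have "sum_list (map tsize fs) \<noteq> n" if "length fs = j + k'" for fs
          using length_le_sum_tsize[of fs] that \<open>j > n - k'\<close> by linarith
        then show ?thesis by (auto simp: forests_def)
      qed
      have "F = (\<Sum>j\<le>n - k'. \<Sum>gs\<in>forests n (j + k'). h (add_mset j (sum_list (map outdegs gs))))"
        unfolding F by (rule sum.mono_neutral_right) (auto simp: empty)
      then have "real n * F = (\<Sum>j\<le>n - k'. real n * (\<Sum>gs\<in>forests n (j + k'). h (add_mset j (sum_list (map outdegs gs)))))"
        by (simp add: sum_distrib_left)
      also have "\<dots> = (\<Sum>j\<le>n - k'. real (j + k') * (\<Sum>ys\<in>compositions n (n - k' - j). h (add_mset j (mset ys))))"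
      proof (rule sum.cong[OF refl])
        fix j assume "j \<in> {..n - k'}"
        then show "real n * (\<Sum>gs\<in>forests n (j + k'). h (add_mset j (sum_list (map outdegs gs)))) =
          real (j + k') * (\<Sum>ys\<in>compositions n (n - k' - j). h (add_mset j (mset ys)))"
          using Suc.IH[of "j + k'" "\<lambda>M. h (add_mset j M)"] k' by (simp add: diff_diff_left add.commute)
      qed
      also have "\<dots> = (\<Sum>xs\<in>compositions (Suc n) (n - k'). real (hd xs + k') * h (add_mset (hd xs) (mset (tl xs))))"
        by (subst sum_compositions_Suc[where f="\<lambda>j ys. real (j + k') * h (add_mset j (mset ys))"])
           (simp add: sum_distrib_left)
      also have "\<dots> = (\<Sum>xs\<in>compositions (Suc n) (n - k'). real (hd xs) * h (mset xs) + real k' * h (mset xs))"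
        by (intro sum.cong refl) (auto simp: compositions_def length_Suc_conv algebra_simps)
      also have "\<dots> = (\<Sum>xs\<in>compositions (Suc n) (n - k'). real (hd xs) * h (mset xs)) + real k' * H"
        by (simp add: H_def sum.distrib sum_distrib_left)
      \<comment> \<open>The average over the head contributes \<open>n - k'\<close>, and (n - k') +
        (n + 1) k' = n (k' + 1).\<close>
      finally have "real (Suc n) * (real n * F) = real (n - k') * H + real (Suc n) * real k' * H"
        using sum_compositions_hd[where n=n and s="n - k'" and h=h] by (simp add: H_def distrib_left)
      also have "\<dots> = real n * (real (Suc k') * H)"
        using k' by (simp add: of_nat_diff algebra_simps)
      finally show ?thesis using False by simp
    qed
    then show ?thesis using k by (simp add: F_def H_def)
  qed
qed

lemma trees_forests: "bij_betw (\<lambda>T. [T]) {T. tsize T = n} (forests n 1)"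
  by (rule bij_betwI[where g=hd]) (auto simp: forests_def length_Suc_conv)

lemma finite_trees: "finite {T. tsize T = n}"
  using bij_betw_finite[OF trees_forests] finite_forests by blast

lemma sum_gw_weight:
  "real (Suc n) * (\<Sum>T | tsize T = Suc n. gw_weight \<mu> T * h (outdegs T)) =
    (\<Sum>xs\<in>compositions (Suc n) n. prod_list (map \<mu> xs) * h (mset xs))"
proof -
  have "(\<Sum>T | tsize T = Suc n. gw_weight \<mu> T * h (outdegs T)) =
    (\<Sum>fs\<in>forests (Suc n) 1. prod_mset (image_mset \<mu> (sum_list (map outdegs fs))) * h (sum_list (map outdegs fs)))"
    by (subst sum.reindex_bij_betw[OF trees_forests, symmetric]) (simp add: gw_weight_outdegs)
  then show ?thesis
    using otter_dwass[of 1 "Suc n" "\<lambda>M. prod_mset (image_mset \<mu> M) * h M"]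
    by (simp add: prod_mset_prod_list flip: mset_map)
qed

section \<open>The conditioned tree\<close>

lemma expectation_walk_compositions:
  fixes h :: "nat list \<Rightarrow> real"
  shows "measure_pmf.expectation (replicate_pmf n p) (\<lambda>xs. h xs * indicator {xs. sum_list xs = s} xs) =
    (\<Sum>xs\<in>compositions n s. prod_list (map (pmf p) xs) * h xs)"
proof -
  have "measure_pmf.expectation (replicate_pmf n p) (\<lambda>xs. h xs * indicator {xs. sum_list xs = s} xs) =
    (\<Sum>xs\<in>compositions n s. h xs * indicator {xs. sum_list xs = s} xs * pmf (replicate_pmf n p) xs)"
    by (rule integral_measure_pmf_real[OF finite_compositions])
       (auto simp: compositions_def indicator_def dest: length_replicate_pmf split: if_splits)
  also have "\<dots> = (\<Sum>xs\<in>compositions n s. prod_list (map (pmf p) xs) * h xs)"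
    by (intro sum.cong refl) (auto simp: compositions_def pmf_replicate_pmf)
  finally show ?thesis .
qed

lemma gw_weight_nonneg:
  assumes "\<And>k. 0 \<le> \<mu> k"
  shows "0 \<le> gw_weight \<mu> T"
proof (induction T)
  case (Node ts)
  then show ?case using assms by (auto intro!: mult_nonneg_nonneg prod_list_nonneg)
qed

lemma sum_gw_weight_expectation:
  "real (Suc n) * (\<Sum>T | tsize T = Suc n. gw_weight (pmf p) T * h (outdegs T)) =
    measure_pmf.expectation (replicate_pmf (Suc n) p) (\<lambda>xs. h (mset xs) * indicator {xs. sum_list xs = n} xs)"
  unfolding expectation_walk_compositions by (rule sum_gw_weight)

text \<open>With division by zero equal to 0, both sides vanish where the total weight is 0, so the
  formula holds at every size.\<close>

lemma integral_gw_cond: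
  fixes F :: "ptree \<Rightarrow> real"
  assumes "\<And>k. 0 \<le> \<mu> k"
  shows "(\<integral>T. F T \<partial>gw_cond \<mu> n) = (\<Sum>T | tsize T = n. gw_weight \<mu> T * F T) / (\<Sum>T | tsize T = n. gw_weight \<mu> T)"
proof -
  define Z where "Z = (\<Sum>T | tsize T = n. gw_weight \<mu> T)"
  have Z: "0 \<le> Z" unfolding Z_def by (intro sum_nonneg gw_weight_nonneg assms)
  have W: "0 \<le> gw_weight \<mu> T" for T by (intro gw_weight_nonneg assms)
  define w where "w T = (if tsize T = n then gw_weight \<mu> T / Z else 0)" for T
  have "gw_cond \<mu> n = density (count_space UNIV) (\<lambda>T. ennreal (w T))"
    unfolding gw_cond_def Z_def[symmetric] w_def by (intro density_cong) auto
  then have "(\<integral>T. F T \<partial>gw_cond \<mu> n) = (\<integral>T. w T * F T \<partial>count_space UNIV)"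
    by (simp only:) (subst integral_density; auto simp: w_def Z W)
  also have "\<dots> = (\<Sum>T | T \<in> UNIV \<and> w T * F T \<noteq> 0. w T * F T)"
    by (rule lebesgue_integral_count_space_finite_support) (rule finite_subset[OF _ finite_trees[of n]], auto simp: w_def)
  also have "\<dots> = (\<Sum>T | tsize T = n. w T * F T)"
    by (rule sum.mono_neutral_left[OF finite_trees]) (auto simp: w_def)
  also have "\<dots> = (\<Sum>T | tsize T = n. gw_weight \<mu> T * F T) / Z"
    by (simp add: w_def sum_divide_distrib)
  finally show ?thesis by (simp add: Z_def)
qed

lemma prob_space_gw_cond:
  assumes \<mu>: "\<And>k. 0 \<le> \<mu> k" and Z: "(\<Sum>T | tsize T = n. gw_weight \<mu> T) > 0"
  shows "prob_space (gw_cond \<mu> n)"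
proof
  have W: "0 \<le> gw_weight \<mu> T" for T by (intro gw_weight_nonneg \<mu>)
  let ?Z = "\<Sum>T | tsize T = n. gw_weight \<mu> T"
  have "emeasure (gw_cond \<mu> n) (space (gw_cond \<mu> n)) =
    (\<integral>\<^sup>+T. (if tsize T = n then ennreal (gw_weight \<mu> T / ?Z) else 0) \<partial>count_space UNIV)"
    unfolding gw_cond_def by (simp add: emeasure_density)
  also have "\<dots> = (\<Sum>T | tsize T = n. ennreal (gw_weight \<mu> T / ?Z))"
    by (subst nn_integral_count_space'[OF finite_trees[of n]]) auto
  also have "\<dots> = ennreal (\<Sum>T | tsize T = n. gw_weight \<mu> T / ?Z)"
    using W Z by (intro sum_ennreal) auto
  also have "\<dots> = 1" using Z by (simp flip: sum_divide_distrib)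
  finally show "emeasure (gw_cond \<mu> n) (space (gw_cond \<mu> n)) = 1" .
qed

context heavy_tail
begin

text \<open>An affine map carries [-D, D] onto [0, 1] and commutes with the conditional expectation
  as soon as the event has positive probability. \<open>D = C + 1\<close> is positive even if
  \<open>C = 0\<close>.\<close>

lemma conditional_expectation_tendsto_bounded:
  fixes f f' :: "nat \<Rightarrow> nat list \<Rightarrow> real"
  assumes f: "\<And>n xs. \<bar>f n xs\<bar> \<le> C" and f': "\<And>n xs. \<bar>f' n xs\<bar> \<le> C"
    and ff': "\<And>n xs i. i < length xs \<Longrightarrow> K < real (xs ! i) \<Longrightarrow> f n xs = f' n (remove_nth i xs)"
    and lim: "(\<lambda>n. measure_pmf.expectation (replicate_pmf n p) (f' n)) \<longlonglongrightarrow> L"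
  shows "(\<lambda>n. measure_pmf.expectation (replicate_pmf (Suc n) p) (\<lambda>xs. f n xs * indicator {xs. sum_list xs = n} xs) /
      measure_pmf.prob (replicate_pmf (Suc n) p) {xs. sum_list xs = n}) \<longlonglongrightarrow> L"
proof -
  define D where "D = C + 1"
  have D: "D > 0" using f[of 0 "[]"] unfolding D_def by linarith
  have fD: "\<bar>f n xs\<bar> \<le> D" "\<bar>f' n xs\<bar> \<le> D" for n xs
    using f[of n xs] f'[of n xs] by (auto simp: D_def)
  have unit: "0 \<le> (y + D) / (2 * D)" "(y + D) / (2 * D) \<le> 1" if "\<bar>y\<bar> \<le> D" for y
    using that D by (auto simp: divide_simps)
  have intf': "integrable (walk n) (f' n)" for n
    using f' by (intro measure_pmf.integrable_const_bound[where B=C]) auto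
  have intf: "integrable (walk (Suc n)) (\<lambda>xs. f n xs * indicator {xs. sum_list xs = n} xs)" for n
  proof (rule measure_pmf.integrable_const_bound[where B=D])
    show "AE xs in walk (Suc n). norm (f n xs * indicator {xs. sum_list xs = n} xs) \<le> D"
      using fD(1) D by (intro AE_I2) (auto simp: indicator_def)
  qed simp
  have inti: "integrable (walk (Suc n)) (indicat_real {xs. sum_list xs = n})" for n
    by (intro measure_pmf.integrable_const_bound[where B=1]) auto
  define P where "P n = measure_pmf.prob (replicate_pmf (Suc n) p) {xs. sum_list xs = n}" for n
  define U where "U n = measure_pmf.expectation (replicate_pmf (Suc n) p) (\<lambda>xs. f n xs * indicator {xs. sum_list xs = n} xs)" for n
  have "(\<lambda>n. measure_pmf.expectation (replicate_pmf n p) (\<lambda>ys. (f' n ys + D) / (2 * D))) \<longlonglongrightarrow> (L + D) / (2 * D)"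
    using D intf' by (simp add: measure_pmf.prob_space) (intro tendsto_intros lim, simp)
  then have "(\<lambda>n. measure_pmf.expectation (replicate_pmf (Suc n) p) (\<lambda>xs. (f n xs + D) / (2 * D) * indicator {xs. sum_list xs = n} xs) / P n)
    \<longlonglongrightarrow> (L + D) / (2 * D)"
    unfolding P_def
    by (rule conditional_expectation_tendsto[where K=K, OF unit(1)[OF fD(1)] unit(2)[OF fD(1)] unit(1)[OF fD(2)] unit(2)[OF fD(2)], rotated])
       (simp_all only: ff')
  moreover have "measure_pmf.expectation (replicate_pmf (Suc n) p) (\<lambda>xs. (f n xs + D) / (2 * D) * indicator {xs. sum_list xs = n} xs)
    = (U n + D * P n) / (2 * D)" for n
  proof -
    have "(\<lambda>xs. (f n xs + D) / (2 * D) * indicator {xs. sum_list xs = n} xs) =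
      (\<lambda>xs. (f n xs * indicator {xs. sum_list xs = n} xs + D * indicator {xs. sum_list xs = n} xs) / (2 * D))"
      by (simp add: distrib_right add_divide_distrib)
    then show ?thesis using intf[of n] inti[of n] by (simp add: U_def P_def del: replicate_pmf.simps)
  qed
  ultimately have "(\<lambda>n. (U n + D * P n) / (2 * D) / P n) \<longlonglongrightarrow> (L + D) / (2 * D)"
    by (simp only:)
  then have "(\<lambda>n. 2 * D * ((U n + D * P n) / (2 * D) / P n) - D) \<longlonglongrightarrow> 2 * D * ((L + D) / (2 * D)) - D"
    by (intro tendsto_diff tendsto_mult tendsto_const)
  also have "2 * D * ((L + D) / (2 * D)) - D = L" using D by simp
  finally have lim': "(\<lambda>n. 2 * D * ((U n + D * P n) / (2 * D) / P n) - D) \<longlonglongrightarrow> L" .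
  have "\<forall>\<^sub>F n in sequentially. 2 * D * ((U n + D * P n) / (2 * D) / P n) - D = U n / P n"
    using prob_sum_list_pos unfolding P_def[symmetric]
    by eventually_elim (use D in \<open>simp add: field_simps\<close>)
  with lim' show ?thesis unfolding U_def P_def by (rule Lim_transform_eventually)
qed

lemma gw_partition_pos: "\<forall>\<^sub>F n in sequentially. (\<Sum>T | tsize T = Suc n. gw_weight (pmf p) T) > 0"
  using prob_sum_list_pos
proof eventually_elim
  case (elim n)
  have "real (Suc n) * (\<Sum>T | tsize T = Suc n. gw_weight (pmf p) T) = measure_pmf.prob (replicate_pmf (Suc n) p) {xs. sum_list xs = n}"
    using sum_gw_weight_expectation[of n p "\<lambda>_. 1"] by (simp del: replicate_pmf.simps of_nat_Suc)
  then show ?case using elim by (metis of_nat_0_less_iff zero_less_Suc zero_less_mult_pos)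
qed

text \<open>The factors \<open>Suc n\<close> of the Otter-Dwass formula cancel between numerator and
  denominator.\<close>

lemma integral_gw_cond_outdegs:
  "(\<integral>T. h (outdegs T) \<partial>gw_cond (pmf p) (Suc n)) =
    measure_pmf.expectation (replicate_pmf (Suc n) p) (\<lambda>xs. h (mset xs) * indicator {xs. sum_list xs = n} xs) /
      measure_pmf.prob (replicate_pmf (Suc n) p) {xs. sum_list xs = n}"
proof -
  have B: "real (Suc n) * (\<Sum>T | tsize T = Suc n. gw_weight (pmf p) T) = measure_pmf.prob (replicate_pmf (Suc n) p) {xs. sum_list xs = n}"
    using sum_gw_weight_expectation[of n p "\<lambda>_. 1"] by (simp del: replicate_pmf.simps of_nat_Suc)
  show ?thesis
    unfolding sum_gw_weight_expectation[symmetric] B[symmetric]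
    by (subst integral_gw_cond) (simp_all del: of_nat_Suc)
qed

text \<open>An entry above \<open>N\<close> adds nothing to the sum of \<open>g\<close>, so deleting
  the jump leaves the functional unchanged; this is how finiteness of the degree sets
  enters.\<close>

theorem outdegree_functional_clt:
  fixes g :: "nat \<Rightarrow> real" and \<phi> :: "real \<Rightarrow> real"
  assumes g: "\<And>k. k \<ge> N \<Longrightarrow> g k = 0" and \<phi>: "continuous_on UNIV \<phi>" "bounded (range \<phi>)"
  defines "e \<equiv> measure_pmf.expectation p g"
  shows "(\<lambda>n. \<integral>T. \<phi> ((sum_mset (image_mset g (outdegs T)) - real (Suc n) * e) / sqrt (Suc n)) \<partial>gw_cond (pmf p) (Suc n))
    \<longlonglongrightarrow> (\<integral>x. \<phi> x \<partial>normal_law (measure_pmf.variance p g))"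
proof -
  \<comment> \<open>The normalisation is tied to the index \<open>n\<close> and not to the length of
    the list, so one function serves both the conditioned list of length \<open>n + 1\<close> and
    the free list of length \<open>n\<close>.\<close>
  define f where "f n xs = \<phi> ((sum_mset (image_mset g (mset xs)) - real (Suc n) * e) / sqrt (Suc n))" for n xs
  obtain C where C: "\<And>x. \<bar>\<phi> x\<bar> \<le> C" using \<phi>(2) by (auto simp: bounded_iff)
  have "\<bar>g k\<bar> \<le> (\<Sum>j<N. \<bar>g j\<bar>)" for k
  proof (cases "k < N")
    case True
    then show ?thesis by (intro member_le_sum[of k "{..<N}" "\<lambda>j. \<bar>g j\<bar>"]) auto
  next
    case False
    then show ?thesis using g by (simp add: sum_nonneg)
  qed
  from clt_replicate_pmf[OF this \<phi>, of p]
  have lim: "(\<lambda>n. measure_pmf.expectation (replicate_pmf n p) (f n)) \<longlonglongrightarrow> (\<integral>x. \<phi> x \<partial>normal_law (measure_pmf.variance p g))"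
    by (simp add: f_def[abs_def] e_def sum_mset_sum_list flip: mset_map)
  have "(\<lambda>n. measure_pmf.expectation (replicate_pmf (Suc n) p) (\<lambda>xs. f n xs * indicator {xs. sum_list xs = n} xs) /
      measure_pmf.prob (replicate_pmf (Suc n) p) {xs. sum_list xs = n}) \<longlonglongrightarrow> (\<integral>x. \<phi> x \<partial>normal_law (measure_pmf.variance p g))"
  proof (rule conditional_expectation_tendsto_bounded[where C=C, OF _ _ _ lim])
    fix n xs i assume i: "i < length xs" "real N < real (xs ! i)"
    then have "g (xs ! i) = 0" using g by simp
    then show "f n xs = f n (remove_nth i xs)" using mset_remove_nth[OF i(1)] by (simp add: f_def)
  qed (simp_all add: f_def C)
  moreover have "(\<integral>T. \<phi> ((sum_mset (image_mset g (outdegs T)) - real (Suc n) * e) / sqrt (Suc n)) \<partial>gw_cond (pmf p) (Suc n)) =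
    measure_pmf.expectation (replicate_pmf (Suc n) p) (\<lambda>xs. f n xs * indicator {xs. sum_list xs = n} xs) /
      measure_pmf.prob (replicate_pmf (Suc n) p) {xs. sum_list xs = n}" for n
    unfolding f_def
    by (rule integral_gw_cond_outdegs[where h="\<lambda>M. \<phi> ((sum_mset (image_mset g M) - real (Suc n) * e) / sqrt (Suc n))"])
  ultimately show ?thesis by simp
qed

end

section \<open>The Gaussian limit vector and the joint convergence\<close>

lemma pmf_of_offspring_distribution:
  assumes "offspring_distribution \<mu>"
  obtains p where "pmf p = \<mu>"
proof
  have \<mu>: "\<And>k. 0 \<le> \<mu> k" "\<mu> sums 1" using assms by (auto simp: offspring_distribution_def)
  have "(\<integral>\<^sup>+k. ennreal (\<mu> k) \<partial>count_space UNIV) = 1"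
    using suminf_ennreal_eq[OF \<mu>] by (simp add: nn_integral_count_space_nat)
  then show "pmf (embed_pmf \<mu>) = \<mu>" using \<mu>(1) by (intro ext pmf_embed_pmf) auto
qed

lemma mu_set_eq_prob: "finite A \<Longrightarrow> mu_set (pmf p) A = measure_pmf.prob p A"
  by (simp add: mu_set_def measure_measure_pmf_finite)

text \<open>The inner product of \<open>t\<close> with the vector of counts is the sum of this
  \<open>g\<close> over all outdegrees. Expanding its variance bilinearly gives the limiting
  covariance, whose diagonal is mu_A (1 - mu_A) since \<open>A i \<inter> A i = A i\<close>.\<close>

lemma weighted_indicator_moments:
  fixes t :: "real^'k::finite" and p :: "nat pmf"
  assumes A: "\<And>i. finite (A i)"
  defines "g \<equiv> \<lambda>k. \<Sum>i\<in>UNIV. t $ i * indicator (A i) k"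
  shows "measure_pmf.expectation p g = (\<Sum>i\<in>UNIV. t $ i * mu_set (pmf p) (A i))"
    and "measure_pmf.variance p g = (\<Sum>i\<in>UNIV. \<Sum>j\<in>UNIV. t $ i * t $ j *
      (mu_set (pmf p) (A i \<inter> A j) - mu_set (pmf p) (A i) * mu_set (pmf p) (A j)))"
proof -
  have int: "integrable (measure_pmf p) (indicat_real B)" for B
    by (intro measure_pmf.integrable_const_bound[where B=1]) auto
  show 1: "measure_pmf.expectation p g = (\<Sum>i\<in>UNIV. t $ i * mu_set (pmf p) (A i))"
    unfolding g_def using int by (simp add: mu_set_eq_prob A del: sum_mult_indicator)
  have g2: "(\<lambda>k. (g k)\<^sup>2) = (\<lambda>k. \<Sum>i\<in>UNIV. \<Sum>j\<in>UNIV. t $ i * t $ j * indicator (A i \<inter> A j) k)"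
    unfolding g_def power2_eq_square sum_product by (simp add: indicator_inter_arith mult_ac del: sum_mult_indicator)
  have "integrable (measure_pmf p) g" "integrable (measure_pmf p) (\<lambda>k. (g k)\<^sup>2)"
    unfolding g2 unfolding g_def using int by (auto simp del: sum_mult_indicator)
  then have "measure_pmf.variance p g = measure_pmf.expectation p (\<lambda>k. (g k)\<^sup>2) - (measure_pmf.expectation p g)\<^sup>2"
    by (rule measure_pmf.variance_eq)
  also have "measure_pmf.expectation p (\<lambda>k. (g k)\<^sup>2) = (\<Sum>i\<in>UNIV. \<Sum>j\<in>UNIV. t $ i * t $ j * mu_set (pmf p) (A i \<inter> A j))"
    unfolding g2 using int by (simp add: mu_set_eq_prob A del: sum_mult_indicator)
  also have "(measure_pmf.expectation p g)\<^sup>2 = (\<Sum>i\<in>UNIV. \<Sum>j\<in>UNIV. t $ i * t $ j * (mu_set (pmf p) (A i) * mu_set (pmf p) (A j)))"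
    unfolding 1 power2_eq_square sum_product by (simp add: mult_ac)
  finally show "measure_pmf.variance p g = (\<Sum>i\<in>UNIV. \<Sum>j\<in>UNIV. t $ i * t $ j *
      (mu_set (pmf p) (A i \<inter> A j) - mu_set (pmf p) (A i) * mu_set (pmf p) (A j)))"
    by (simp add: sum_subtractf right_diff_distrib)
qed

text \<open>The vector is a linear image of independent normals attached to the classes
  \<open>0, \<dots>, N - 1\<close> and \<open>[N, \<infinity>)\<close> of outdegrees.\<close>
lemma centered_gaussian_exists:
  fixes A :: "'k::finite \<Rightarrow> nat set"
  assumes A: "\<And>i. finite (A i)"
  shows "\<exists>\<nu>. centered_gaussian \<nu> (\<lambda>i j. mu_set (pmf p) (A i \<inter> A j) - mu_set (pmf p) (A i) * mu_set (pmf p) (A j))"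
proof -
  have "finite (\<Union>i. A i)" using A by auto
  then obtain N where N: "(\<Union>i. A i) \<subseteq> {..<N}" using finite_nat_iff_bounded by blast
  \<comment> \<open>All outdegrees from \<open>N\<close> on are merged into the class
    \<open>N\<close>, which meets no \<open>A i\<close>. Each \<open>w b\<close> is the centred
    indicator vector of class \<open>b\<close>, scaled by the square root of its mass, so the
    rank-one matrices add up to the covariance.\<close>
  define q where "q = map_pmf (min N) p"
  define w where "w b = sqrt (pmf q b) *\<^sub>R (\<chi> i. indicat_real (A i) b - mu_set (pmf p) (A i))" for b
  obtain \<nu> where \<nu>: "prob_space \<nu>" "sets \<nu> = sets borel"
    "\<And>t. distr \<nu> borel (\<lambda>x. t \<bullet> x) = normal_law (\<Sum>b\<in>{..N}. (t \<bullet> w b)\<^sup>2)"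
    using gaussian_linear_image[where w=w and N=N] by blast
  have "(\<Sum>b\<in>{..N}. (t \<bullet> w b)\<^sup>2) = (\<Sum>i\<in>UNIV. \<Sum>j\<in>UNIV. t $ i * t $ j *
      (mu_set (pmf p) (A i \<inter> A j) - mu_set (pmf p) (A i) * mu_set (pmf p) (A j)))" for t
  proof -
    define g where "g = (\<lambda>k. \<Sum>i\<in>UNIV. t $ i * indicator (A i) k)"
    define e where "e = measure_pmf.expectation p g"
    have moments: "measure_pmf.expectation p g = (\<Sum>i\<in>UNIV. t $ i * mu_set (pmf p) (A i))"
      "measure_pmf.variance p g = (\<Sum>i\<in>UNIV. \<Sum>j\<in>UNIV. t $ i * t $ j *
        (mu_set (pmf p) (A i \<inter> A j) - mu_set (pmf p) (A i) * mu_set (pmf p) (A j)))"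
      unfolding g_def by (rule weighted_indicator_moments[OF A])+
    have "t \<bullet> w b = sqrt (pmf q b) * (g b - e)" for b
      by (simp add: w_def inner_vec_def g_def e_def moments(1)[unfolded g_def] sum_subtractf right_diff_distrib sum_distrib_left mult_ac del: sum_mult_indicator)
    then have "(\<Sum>b\<in>{..N}. (t \<bullet> w b)\<^sup>2) = (\<Sum>b\<in>{..N}. (g b - e)\<^sup>2 * pmf q b)"
      by (simp add: power_mult_distrib mult.commute)
    also have "\<dots> = measure_pmf.expectation q (\<lambda>b. (g b - e)\<^sup>2)"
      by (rule integral_measure_pmf_real[symmetric]) (auto simp: q_def)
    also have "\<dots> = measure_pmf.expectation p (\<lambda>k. (g (min N k) - e)\<^sup>2)" by (simp add: q_def)
    also have "(\<lambda>k. g (min N k)) = g"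
    proof
      fix k
      have "j < N" if "j \<in> A i" for i j using N that by blast
      then have "(min N k \<in> A i) = (k \<in> A i)" for i by (cases "k < N") (auto simp: min_def)
      then show "g (min N k) = g k" by (simp add: g_def indicator_def)
    qed
    then have "measure_pmf.expectation p (\<lambda>k. (g (min N k) - e)\<^sup>2) = measure_pmf.variance p g"
      by (simp add: fun_eq_iff e_def)
    finally show ?thesis using moments(2) by simp
  qed
  with \<nu> show ?thesis unfolding centered_gaussian_def by auto
qed

theorem theorem6p7:
  fixes \<mu> :: "nat \<Rightarrow> real" and c \<beta> :: real
    and A :: "'k::finite \<Rightarrow> nat set"
  assumes "offspring_distribution \<mu>"
    and "summable (\<lambda>k. real k * \<mu> k)" and "(\<Sum>k. real k * \<mu> k) < 1"
    and "nonlattice_support \<mu>"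
    and "c > 0" and "\<beta> > 2"
    and "\<mu> \<sim>[at_top] (\<lambda>k. c * real k powr (- \<beta>))"
    and "\<And>i. finite (A i)"
  shows "\<exists>\<nu>. centered_gaussian \<nu>
              (\<lambda>i j. mu_set \<mu> (A i \<inter> A j) - mu_set \<mu> (A i) * mu_set \<mu> (A j)) \<and>
            conv_in_distribution
              (\<lambda>n. distr (gw_cond \<mu> n) borel
                 (\<lambda>T. \<chi> i. (real (count_outdeg (A i) T) - real n * mu_set \<mu> (A i)) / sqrt (real n)))
              \<nu>"
proof -
  obtain p where p: "pmf p = \<mu>" using assms(1) by (rule pmf_of_offspring_distribution)
  have int: "integrable (measure_pmf p) real"
    using assms(2) by (simp add: integrable_measure_pmf_nat_iff p mult.commute)
  interpret heavy_tail p c \<beta> "\<Sum>k. real k * \<mu> k"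
    by unfold_locales (use assms int in \<open>simp_all add: p expectation_measure_pmf_nat mult.commute\<close>)
  define Y where "Y n T = (\<chi> i. (real (count_outdeg (A i) T) - real n * mu_set \<mu> (A i)) / sqrt (real n))" for n T
  obtain \<nu> where \<nu>: "centered_gaussian \<nu> (\<lambda>i j. mu_set \<mu> (A i \<inter> A j) - mu_set \<mu> (A i) * mu_set \<mu> (A j))"
    using centered_gaussian_exists[where A=A and p=p, OF assms(8)] unfolding p by blast
  have meas: "Y n \<in> borel_measurable (gw_cond \<mu> n)" for n
    by (simp add: gw_cond_def)
  have "conv_in_distribution (\<lambda>n. distr (gw_cond \<mu> n) borel (Y n)) \<nu>"
  proof (rule cramer_wold)
    have "\<forall>\<^sub>F n in sequentially. prob_space (distr (gw_cond \<mu> (Suc n)) borel (Y (Suc n)))"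
      using gw_partition_pos
    proof eventually_elim
      case (elim n)
      then have "prob_space (gw_cond \<mu> (Suc n))"
        using prob_space_gw_cond[of "pmf p" "Suc n", OF pmf_nonneg] by (simp add: p)
      then show ?case by (rule prob_space.prob_space_distr[OF _ meas])
    qed
    then show "\<forall>\<^sub>F n in sequentially. prob_space (distr (gw_cond \<mu> n) borel (Y n))"
      by (subst (asm) eventually_sequentially_Suc)
    show "prob_space \<nu>" "sets \<nu> = sets borel" using \<nu> by (auto simp: centered_gaussian_def)
    fix t :: "real^'k" and \<phi> :: "real \<Rightarrow> real"
    assume \<phi>: "continuous_on UNIV \<phi>" "bounded (range \<phi>)"
    define g where "g = (\<lambda>k. \<Sum>i\<in>UNIV. t $ i * indicator (A i) k)"
    have moments: "measure_pmf.expectation p g = (\<Sum>i\<in>UNIV. t $ i * mu_set (pmf p) (A i))"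
      "measure_pmf.variance p g = (\<Sum>i\<in>UNIV. \<Sum>j\<in>UNIV. t $ i * t $ j *
        (mu_set (pmf p) (A i \<inter> A j) - mu_set (pmf p) (A i) * mu_set (pmf p) (A j)))"
      unfolding g_def by (rule weighted_indicator_moments[OF assms(8)])+
    have "finite (\<Union>i. A i)" using assms(8) by auto
    then obtain N where N: "(\<Union>i. A i) \<subseteq> {..<N}" using finite_nat_iff_bounded by blast
    have gN: "g k = 0" if "k \<ge> N" for k
    proof -
      have "k \<notin> A i" for i using N that by fastforce
      then show ?thesis by (simp add: g_def)
    qed
    have \<phi>m: "\<phi> \<in> borel_measurable borel" using \<phi>(1) by (rule borel_measurable_continuous_onI)
    have sum_g: "sum_mset (image_mset g M) = (\<Sum>i\<in>UNIV. t $ i * real (size (filter_mset (\<lambda>d. d \<in> A i) M)))" for M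
    proof (induction M)
      case (add x M)
      have "sum_mset (image_mset g (add_mset x M)) =
        (\<Sum>i\<in>UNIV. t $ i * (indicator (A i) x + real (size (filter_mset (\<lambda>d. d \<in> A i) M))))"
        using add by (simp add: g_def distrib_left sum.distrib del: sum_mult_indicator)
      also have "\<dots> = (\<Sum>i\<in>UNIV. t $ i * real (size (filter_mset (\<lambda>d. d \<in> A i) (add_mset x M))))"
        by (intro sum.cong refl) (simp add: indicator_def)
      finally show ?case .
    qed simp
    have inner: "t \<bullet> Y n T = (sum_mset (image_mset g (outdegs T)) - real n * measure_pmf.expectation p g) / sqrt n" for n T
      by (simp add: Y_def inner_vec_def sum_g moments(1) p count_outdeg_outdegs sum_divide_distrib sum_subtractf
          right_diff_distrib diff_divide_distrib sum_distrib_left mult_ac)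
    \<comment> \<open>A tree of size \<open>Suc n\<close> corresponds to a list of length
      \<open>Suc n\<close> with sum \<open>n\<close>, hence the shifted index, which is undone at
      the end.\<close>
    have "(\<lambda>n. \<integral>T. \<phi> (t \<bullet> Y (Suc n) T) \<partial>gw_cond \<mu> (Suc n)) \<longlonglongrightarrow> (\<integral>x. \<phi> x \<partial>normal_law (measure_pmf.variance p g))"
      unfolding inner using outdegree_functional_clt[OF gN \<phi>] p by simp
    also have "normal_law (measure_pmf.variance p g) = distr \<nu> borel (\<lambda>x. t \<bullet> x)"
      using \<nu> moments(2) by (simp add: centered_gaussian_def p)
    also have "(\<integral>x. \<phi> x \<partial>distr \<nu> borel (\<lambda>x. t \<bullet> x)) = (\<integral>x. \<phi> (t \<bullet> x) \<partial>\<nu>)"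
    proof (rule integral_distr[OF _ \<phi>m])
      have "sets \<nu> = sets borel" using \<nu> by (simp add: centered_gaussian_def)
      then have "borel_measurable \<nu> = (borel_measurable borel :: (real^'k \<Rightarrow> real) set)"
        by (rule measurable_cong_sets) simp
      then show "(\<lambda>x. t \<bullet> x) \<in> borel_measurable \<nu>" by simp
    qed
    finally have "(\<lambda>n. \<integral>T. \<phi> (t \<bullet> Y (Suc n) T) \<partial>gw_cond \<mu> (Suc n)) \<longlonglongrightarrow> (\<integral>x. \<phi> (t \<bullet> x) \<partial>\<nu>)" .
    moreover have "(\<integral>x. \<phi> (t \<bullet> x) \<partial>distr (gw_cond \<mu> n) borel (Y n)) = (\<integral>T. \<phi> (t \<bullet> Y n T) \<partial>gw_cond \<mu> n)" for n
      by (rule integral_distr[OF meas measurable_compose[OF _ \<phi>m]]) simp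
    ultimately have "(\<lambda>n. \<integral>x. \<phi> (t \<bullet> x) \<partial>distr (gw_cond \<mu> (Suc n)) borel (Y (Suc n))) \<longlonglongrightarrow> (\<integral>x. \<phi> (t \<bullet> x) \<partial>\<nu>)"
      by simp
    then show "(\<lambda>n. \<integral>x. \<phi> (t \<bullet> x) \<partial>distr (gw_cond \<mu> n) borel (Y n)) \<longlonglongrightarrow> (\<integral>x. \<phi> (t \<bullet> x) \<partial>\<nu>)"
      by (rule LIMSEQ_imp_Suc)
  qed simp
  with \<nu> show ?thesis unfolding Y_def by blast
qed

end
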